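(* Let $G=(V,E)$ be a connected, undirected, unweighted graph on $n$ nodes with diameter $D$, and let $\mathcal{P}\subseteq V\times V$ be a set of pairs of nodes. Then a $(+2)$-pairwise spanner of $G$ for $\mathcal{P}$ with $O\!\left(n|\mathcal{P}|^{1/3}\log^{2/3} n\right)$ edges can be constructed in $O(\tau(\mathcal{P})+D)$ rounds in the CONGEST model, with high probability.
   Context: $\delta_H(u,v)$ denotes the distance between $u$ and $v$ in a graph $H$. A subgraph $H$ of $G$ (on the same node set) is a $(+2)$-pairwise spanner for $\mathcal{P}$ if $\delta_H(u,v)\le\delta_G(u,v)+2$ for all $(u,v)\in\mathcal{P}$. $\tau(\mathcal{P})$ is the number of nodes appearing in some pair of $\mathcal{P}$, i.e. $|\{u : \exists v,\ \{u,v\}\in\mathcal{P}\}|$. CONGEST model: the nodes of $G$ are processors with unique $O(\log n)$-bit identifiers; computation proceeds in synchronous rounds, in each of which every node may send an $O(\log n)$-bit message to each of its neighbors in $G$, followed by unbounded local computation. Initially each node knows its identifier, its neighbors' identifiers, and all pairs of $\mathcal{P}$ it belongs to; at the end each node must know which of its incident edges belong to $H$. "With high probability" means with probability at least $1-n^{-c}$ for an arbitrarily chosen constant $c$. *)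

theory Defs
  imports "HOL-Probability.Probability" "Graph_Theory.Graph_Theory"
begin

section \<open>Graphs and pairwise spanners\<close>

text \<open>
  Undirected simple graphs are the symmetric loop-free pair digraphs (locale \<open>pair_graph\<close>): an
  edge between \<open>u\<close> and \<open>v\<close> is represented by the two arcs \<open>(u,v)\<close> and \<open>(v,u)\<close>.
\<close>

text \<open>Unit weights; the value is \<open>\<infinity>\<close> if \<open>v\<close> is not reachable from \<open>u\<close>.\<close>

definition gdist :: "'a pair_pre_digraph \<Rightarrow> 'a \<Rightarrow> 'a \<Rightarrow> ereal" where
  "gdist G u v = wf_digraph.\<mu> (with_proj G) (\<lambda>_. 1) u v"

text \<open>Meaningful for connected graphs only: an infinite supremum is mapped to \<open>0\<close>.\<close>

definition gdiameter :: "'a pair_pre_digraph \<Rightarrow> real" where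
  "gdiameter G = real_of_ereal (SUP u\<in>pverts G. SUP v\<in>pverts G. gdist G u v)"

definition num_edges :: "'a pair_pre_digraph \<Rightarrow> nat" where
  "num_edges G = card {{u, v} | u v. (u, v) \<in> parcs G}"

definition pairwise_spanner ::
  "real \<Rightarrow> 'a pair_pre_digraph \<Rightarrow> ('a \<times> 'a) set \<Rightarrow> 'a pair_pre_digraph \<Rightarrow> bool" where
  "pairwise_spanner b G P H \<longleftrightarrow>
     pair_graph H \<and> spanning (with_proj H) (with_proj G) \<and>
     (\<forall>(u, v)\<in>P. gdist H u v \<le> gdist G u v + ereal b)"

definition num_pair_nodes :: "('a \<times> 'a) set \<Rightarrow> nat" where
  "num_pair_nodes P = card {u. \<exists>v. (u, v) \<in> P \<or> (v, u) \<in> P}"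


section \<open>Randomized algorithms in the CONGEST model\<close>

text \<open>
  Identifiers are unique, so a node is represented by its identifier, a natural number.

  Local computation is unbounded, hence a node may be assumed to remember everything it has seen:
  its local view consists of its initial knowledge and, for each past round, the value of its
  private random draw in that round and the messages received in that round, indexed by sender.
  An algorithm is an arbitrary function of this view.  It is the same for all nodes and all
  networks; in particular nodes are not told the number of nodes.
\<close>

type_synonym message = "bool list"

record knowledge =
  own_id :: nat
  nbr_ids :: "nat set"
  own_pairs :: "(nat \<times> nat) set"

record local_view =
  initial :: knowledge
  history :: "(nat \<times> (nat \<Rightarrow> message option)) list"

text \<open>
  \<open>draw\<close> is the distribution of the private random value used by an undecided node in the coming
  round, and \<open>send\<close> gives, from the view and this value, the message (if any) for each neighbour.
  \<open>decide\<close> is \<open>None\<close> while the node is still running; \<open>Some X\<close> means that it has terminated with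
  output \<open>X\<close>, the set of neighbours to which it is joined by a selected edge.
\<close>

record congest_algorithm =
  draw :: "local_view \<Rightarrow> nat pmf"
  send :: "local_view \<Rightarrow> nat \<Rightarrow> nat \<Rightarrow> message option"
  decide :: "local_view \<Rightarrow> nat set option"

type_synonym configuration = "nat \<Rightarrow> local_view"

definition initial_config ::
  "nat pair_pre_digraph \<Rightarrow> (nat \<times> nat) set \<Rightarrow> configuration" where
  "initial_config G P v =
     \<lparr> initial = \<lparr> own_id = v, nbr_ids = {w. (v, w) \<in> parcs G},
                   own_pairs = {(a, b) \<in> P. a = v \<or> b = v} \<rparr>,
       history = [] \<rparr>"

text \<open>The message crossing the arc \<open>(u,v)\<close>.  A terminated node stays silent.\<close>

definition sent ::
  "congest_algorithm \<Rightarrow> nat pair_pre_digraph \<Rightarrow> configuration \<Rightarrow> (nat \<Rightarrow> nat) \<Rightarrow>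
     nat \<Rightarrow> nat \<Rightarrow> message option" where
  "sent A G cf d u v =
     (if (u, v) \<in> parcs G \<and> decide A (cf u) = None then send A (cf u) (d u) v else None)"

text \<open>A terminated node never changes its view again, so its output is irrevocable.\<close>

definition next_config ::
  "congest_algorithm \<Rightarrow> nat pair_pre_digraph \<Rightarrow> configuration \<Rightarrow> (nat \<Rightarrow> nat) \<Rightarrow> configuration" where
  "next_config A G cf d v =
     (if v \<in> pverts G \<and> decide A (cf v) = None
      then (cf v)\<lparr> history := history (cf v) @ [(d v, \<lambda>u. sent A G cf d u v)] \<rparr>
      else cf v)"

definition draws ::
  "congest_algorithm \<Rightarrow> nat pair_pre_digraph \<Rightarrow> configuration \<Rightarrow> (nat \<Rightarrow> nat) pmf" where
  "draws A G cf = Pi_pmf (pverts G) 0 (\<lambda>v. draw A (cf v))"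

primrec run ::
  "congest_algorithm \<Rightarrow> nat pair_pre_digraph \<Rightarrow> (nat \<times> nat) set \<Rightarrow> nat \<Rightarrow> configuration pmf" where
  "run A G P 0 = return_pmf (initial_config G P)"
| "run A G P (Suc r) =
     bind_pmf (run A G P r) (\<lambda>cf. map_pmf (next_config A G cf) (draws A G cf))"

text \<open>In every possible execution, every message has at most \<open>B log n\<close> bits.\<close>

definition respects_bandwidth ::
  "real \<Rightarrow> congest_algorithm \<Rightarrow> nat pair_pre_digraph \<Rightarrow> (nat \<times> nat) set \<Rightarrow> bool" where
  "respects_bandwidth B A G P \<longleftrightarrow>
     (\<forall>r. \<forall>cf \<in> set_pmf (run A G P r). \<forall>d \<in> set_pmf (draws A G cf). \<forall>u v m.
        sent A G cf d u v = Some m \<longrightarrow> real (length m) \<le> B * log 2 (real (card (pverts G))))"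

text \<open>All nodes have terminated, and each node has output exactly its incident edges in \<open>H\<close>.\<close>

definition outputs_graph ::
  "congest_algorithm \<Rightarrow> nat pair_pre_digraph \<Rightarrow> configuration \<Rightarrow> nat pair_pre_digraph \<Rightarrow> bool" where
  "outputs_graph A G cf H \<longleftrightarrow>
     (\<forall>v\<in>pverts G. decide A (cf v) = Some {w. (v, w) \<in> parcs H})"

end

theory Submission
  imports Defs
begin

text \<open>
  Let \<open>T\<close> be the set of nodes occurring in pairs and \<open>Q \<approx> |P|\<^bsup>1/3\<^esup> log\<^bsup>2/3\<^esup> n\<close>.  If \<open>|T| \<le> Q\<close>, the
  breadth-first trees of all of \<open>T\<close> form the spanner.  Otherwise \<open>Q\<close> random centers are chosen and
  their trees are bought.  For every pair \<open>(u,v)\<close>, the tree path from \<open>v\<close> towards \<open>u\<close> is bought until it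
  meets a node \<open>w\<close> that is, or is adjacent to, a center \<open>r\<close>.  If it meets none, the whole shortest path
  is present; if it meets one, the detour through \<open>r\<close> costs at most 2 more than the shortest path, so
  the stretch does not depend on the random choices.  Edges bought at nodes of degree less than \<open>Q\<close>
  number at most \<open>n Q\<close>.  A shortest path with \<open>l\<close> nodes of larger degree has about \<open>l Q / 3\<close>
  neighbours, so with high probability a center is met before \<open>l \<approx> n log n / Q\<^sup>2\<close> of them are passed,
  and the remaining edges number \<open>O(|P| l) = O(n Q)\<close>.

  All floods are pipelined: each node sends its smallest unsent item, which delays an item by at most
  its rank.  Termination of the first flood, and with it a bound on the diameter, is recognised
  simultaneously by all nodes from the last change they have heard of.  Purchases are forwarded along
  the trees in the time-reversed order of the search.
\<close>

section \<open>Hop distances\<close>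

text \<open>Nodes know neither \<open>n\<close> nor \<open>D\<close> nor \<open>|P|\<close>, and the
  round budget allows neither gathering one item per node nor waiting for a time depending on
  \<open>n\<close>. So a flood of the maximal identifier runs beside that of the pair counts: both
  are quiet after \<open>D + tau\<close> rounds, and as the maximum has then reached everybody,
  twice the quiet time bounds all distances, even for empty \<open>P\<close>. Every later phase is
  clocked by this number plus a number of keys. In logarithms \<open>N\<close>, the largest
  identifier plus one, replaces \<open>n\<close>; \<open>N <= n^k\<close> costs a constant factor.
  Sampling with probability \<open>Q / n\<close> is impossible without \<open>n\<close>: each node
  draws a geometric level and the \<open>Q\<close> highest win. The analysis picks \<open>j\<close>
  with \<open>n / 2^j\<close> between \<open>Q/8\<close> and \<open>Q/4\<close>; the nodes of level
  at least \<open>j\<close> are independent and are all centers unless there are more than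
  \<open>Q\<close> of them. The edge count alone would allow \<open>Q^3\<close> near
  \<open>|P| log n\<close>; the larger power of the logarithm makes \<open>Q\<close> exceed a
  multiple of \<open>log n\<close> whenever \<open>Q < |T|\<close>, as the bound on that sample
  requires. Levels are drawn in the first round, so the rest of a run is a deterministic function of
  independent seeds.\<close>

locale network =
  fixes V :: "nat set" and E :: "(nat \<times> nat) set"
  assumes finite_V: "finite V"
    and E_subset: "E \<subseteq> V \<times> V"
    and E_sym: "(u, v) \<in> E \<Longrightarrow> (v, u) \<in> E"
    and E_irrefl: "(v, v) \<notin> E"
    and E_conn: "u \<in> V \<Longrightarrow> v \<in> V \<Longrightarrow> (u, v) \<in> E\<^sup>*"
    and V_nonempty: "V \<noteq> {}"
begin

definition hop :: "nat \<Rightarrow> nat \<Rightarrow> nat" where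
  "hop u v = (LEAST n. (u, v) \<in> E ^^ n)"

lemma hop_relpow: "u \<in> V \<Longrightarrow> v \<in> V \<Longrightarrow> (u, v) \<in> E ^^ hop u v"
  unfolding hop_def using E_conn[of u v] by (auto intro: LeastI_ex simp: rtrancl_power)

lemma hop_le: "(u, v) \<in> E ^^ n \<Longrightarrow> hop u v \<le> n"
  unfolding hop_def by (rule Least_le)

lemma relpow_sym: "(u, v) \<in> E ^^ n \<Longrightarrow> (v, u) \<in> E ^^ n"
proof (induction n arbitrary: v)
  case (Suc n)
  then obtain w where "(u, w) \<in> E ^^ n" "(w, v) \<in> E" by auto
  then show ?case using Suc.IH[of w] E_sym[of w v] by (metis relpow_Suc_I2)
qed auto

lemma hop_sym: "u \<in> V \<Longrightarrow> v \<in> V \<Longrightarrow> hop u v = hop v u"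
  by (simp add: hop_le hop_relpow relpow_sym le_antisym)

lemma hop_self [simp]: "hop u u = 0"
  using hop_le[of u u 0] by simp

lemma hop_triangle: "u \<in> V \<Longrightarrow> v \<in> V \<Longrightarrow> w \<in> V \<Longrightarrow> hop u w \<le> hop u v + hop v w"
  by (rule hop_le) (auto simp: relpow_add intro!: relcompI hop_relpow)

lemma hop_edge: "(u, v) \<in> E \<Longrightarrow> hop u v = 1"
proof -
  assume a: "(u, v) \<in> E"
  then have "hop u v \<le> 1" by (intro hop_le) auto
  moreover have "hop u v \<noteq> 0"
    using hop_relpow[of u v] a E_irrefl E_subset by (cases "hop u v") auto
  ultimately show ?thesis by linarith
qed

lemma hop_eq_0: "u \<in> V \<Longrightarrow> v \<in> V \<Longrightarrow> hop u v = 0 \<longleftrightarrow> u = v"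
  using hop_relpow[of u v] by (cases "hop u v = 0") auto

lemma hop_nbr_le: "u \<in> V \<Longrightarrow> (v, w) \<in> E \<Longrightarrow> hop u w \<le> Suc (hop u v)"
  using hop_triangle[of u v w] hop_edge[of v w] E_subset by auto

lemma hop_pred:
  assumes "u \<in> V" "v \<in> V" "hop u v = Suc d"
  obtains w where "(w, v) \<in> E" "hop u w = d"
proof -
  have "(u, v) \<in> E ^^ Suc d" using hop_relpow[of u v] assms by simp
  then obtain w where w: "(u, w) \<in> E ^^ d" "(w, v) \<in> E" by auto
  then have "hop u w \<le> d" "Suc d \<le> Suc (hop u w)"
    using hop_le[OF w(1)] hop_nbr_le[of u w v] assms by auto
  then show ?thesis using that w by auto
qed

lemma hop_intermediate:
  assumes "u \<in> V" "v \<in> V" "r \<le> hop u v"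
  shows "\<exists>w\<in>V. hop u w = r"
  using assms(2,3)
proof (induction "hop u v - r" arbitrary: v)
  case 0
  then show ?case by auto
next
  case (Suc x)
  then obtain d where d: "hop u v = Suc d" by (cases "hop u v") auto
  then obtain w where "(w, v) \<in> E" "hop u w = d" using hop_pred assms(1) Suc.prems by metis
  then show ?case using Suc d E_subset by (intro Suc.hyps(1)[of w]) auto
qed

lemma hop_less_card:
  assumes "u \<in> V" "v \<in> V" shows "hop u v < card V"
proof -
  have "{..hop u v} \<subseteq> hop u ` V"
    using hop_intermediate[OF assms] by (force simp: image_iff)
  then have "card {..hop u v} \<le> card V"
    using finite_V by (meson card_image_le card_mono finite_imageI le_trans)
  then show ?thesis by simp
qed

end

section \<open>Pipelined flooding\<close>

text \<open>An item is a pair of an entry and a key, and \<open>a\<close> is added to the entry at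
  each hop: \<open>a = 0\<close> gives a broadcast of keys, \<open>a = 1\<close> a search for
  distances. Heard items keep their sender, because tree parents are later read off them.\<close>

definition known :: "nat \<Rightarrow> nat set \<Rightarrow> (nat \<times> nat \<times> nat) set \<Rightarrow> (nat \<times> nat) set" where
  "known a own R = {(0, k) |k. k \<in> own} \<union> {(e + a, k) |e k. \<exists>w. (w, e, k) \<in> R}"

definition pending :: "(nat \<times> nat) set \<Rightarrow> (nat \<times> nat) set \<Rightarrow> (nat \<times> nat) set" where
  "pending K S = {(e, k) \<in> K. (e, k) \<notin> S \<and> (\<forall>e'. (e', k) \<in> K \<longrightarrow> e \<le> e')}"

text \<open>Only the best entry of a key is ever sent, the lexicographically smallest one first.\<close>

definition next_item :: "(nat \<times> nat) set \<Rightarrow> (nat \<times> nat) set \<Rightarrow> (nat \<times> nat) option" where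
  "next_item K S =
     (let C = pending K S; e = (LEAST e. \<exists>k. (e, k) \<in> C)
      in if C = {} then None else Some (e, LEAST k. (e, k) \<in> C))"

definition lex_le :: "nat \<times> nat \<Rightarrow> nat \<times> nat \<Rightarrow> bool" where
  "lex_le i j \<longleftrightarrow> fst i < fst j \<or> fst i = fst j \<and> snd i \<le> snd j"

lemma lex_le_pair: "lex_le (e, k) (e', k') \<longleftrightarrow> e < e' \<or> e = e' \<and> k \<le> k'"
  by (simp add: lex_le_def)

lemma lex_le_shift:
  "lex_le (x, k) (y, k') \<Longrightarrow> z \<le> x + a \<Longrightarrow> y + a = y' \<Longrightarrow> lex_le (z, k) (y', k')"
  by (auto simp: lex_le_pair)

lemma lex_le_graph_trans:
  "lex_le (f x, x) (f y, y) \<and> x \<noteq> y \<Longrightarrow> lex_le (f y, y) (f z, z) \<and> y \<noteq> z \<Longrightarrow>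
    lex_le (f x, x) (f z, z) \<and> x \<noteq> z"
  for f :: "nat \<Rightarrow> nat"
  by (auto simp: lex_le_pair)

lemma next_item_None: "next_item K S = None \<longleftrightarrow> pending K S = {}"
  by (simp add: next_item_def Let_def)

lemma next_item_Some:
  assumes "next_item K S = Some i"
  shows "i \<in> pending K S" "j \<in> pending K S \<Longrightarrow> lex_le i j"
proof -
  define C where "C = pending K S"
  define e where "e = (LEAST e. \<exists>k. (e, k) \<in> C)"
  have ne: "C \<noteq> {}" and i: "i = (e, LEAST k. (e, k) \<in> C)"
    using assms by (auto simp: next_item_def Let_def C_def e_def split: if_splits)
  have "\<exists>e k. (e, k) \<in> C" using ne by auto
  then have ex: "\<exists>k. (e, k) \<in> C" unfolding e_def by (rule LeastI_ex)
  then show "i \<in> pending K S" unfolding C_def[symmetric] i by (rule LeastI_ex)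
  assume j: "j \<in> pending K S"
  have "e \<le> fst j" unfolding e_def using j by (intro Least_le) (auto simp: C_def intro: exI[of _ "snd j"])
  moreover have "(LEAST k. (e, k) \<in> C) \<le> snd j" if "e = fst j"
    using j that by (intro Least_le) (auto simp: C_def)
  ultimately show "lex_le i j" by (auto simp: lex_le_def i)
qed

lemma next_item_fresh: "next_item K S = Some i \<Longrightarrow> i \<in> K \<and> i \<notin> S"
  using next_item_Some(1)[of K S i] by (auto simp: pending_def)

definition (in network) received :: "(nat \<Rightarrow> 'm set) \<Rightarrow> nat \<Rightarrow> (nat \<times> 'm) set" where
  "received S v = {(w, i). (w, v) \<in> E \<and> i \<in> S w}"

locale flooding = network V E for V E +
  fixes a :: nat and own :: "nat \<Rightarrow> nat set" and owner :: "nat \<Rightarrow> nat"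
  assumes finite_own: "v \<in> V \<Longrightarrow> finite (own v)"
    and owner: "v \<in> V \<Longrightarrow> k \<in> own v \<Longrightarrow> owner k = v"
begin

definition keys :: "nat set" where "keys = (\<Union>v\<in>V. own v)"

primrec sent_by :: "nat \<Rightarrow> nat \<Rightarrow> (nat \<times> nat) set" where
  "sent_by 0 v = {}"
| "sent_by (Suc t) v = sent_by t v \<union>
     set_option (next_item (known a (own v) (received (sent_by t) v)) (sent_by t v))"

abbreviation known_by :: "nat \<Rightarrow> nat \<Rightarrow> (nat \<times> nat) set" where
  "known_by t v \<equiv> known a (own v) (received (sent_by t) v)"

abbreviation item :: "nat \<Rightarrow> nat \<Rightarrow> (nat \<times> nat) option" where
  "item t v \<equiv> next_item (known_by t v) (sent_by t v)"

definition key_dist :: "nat \<Rightarrow> nat \<Rightarrow> nat" where "key_dist v k = hop (owner k) v"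

definition before :: "nat \<Rightarrow> nat \<Rightarrow> nat \<Rightarrow> bool" where
  "before v k' k \<longleftrightarrow> lex_le (a * key_dist v k', k') (a * key_dist v k, k) \<and> k' \<noteq> k"

definition rank :: "nat \<Rightarrow> nat \<Rightarrow> nat" where
  "rank v k = card {k' \<in> keys. before v k' k}"

text \<open>The round in which \<open>v\<close> sends the final entry of \<open>k\<close> at the
  latest: one round of delay for each hop and for each key that precedes \<open>k\<close> in the
  order at \<open>v\<close>. The clocks of the later phases are bounds on slots.\<close>

definition slot :: "nat \<Rightarrow> nat \<Rightarrow> nat" where "slot v k = key_dist v k + rank v k"

lemma finite_keys: "finite keys"
  by (auto simp: keys_def finite_V finite_own)

lemma owner_in: "k \<in> keys \<Longrightarrow> owner k \<in> V \<and> k \<in> own (owner k)"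
  using owner by (auto simp: keys_def)

lemma rank_less: "k \<in> keys \<Longrightarrow> rank v k < card keys"
  unfolding rank_def by (intro psubset_card_mono finite_keys) (auto simp: before_def)

lemma sent_mono: "t \<le> t' \<Longrightarrow> sent_by t v \<subseteq> sent_by t' v"
  by (rule lift_Suc_mono_le[of "\<lambda>t. sent_by t v"]) auto

lemma known_mono: "t \<le> t' \<Longrightarrow> known_by t v \<subseteq> known_by t' v"
  using sent_mono[of t t'] by (fastforce simp: known_def received_def)

lemma sent_Suc_known: "sent_by (Suc t) v \<subseteq> known_by t v"
proof (induction t)
  case 0
  then show ?case using next_item_fresh[of "known_by 0 v" "{}"] by (cases "item 0 v") (auto simp: received_def known_def)
next
  case (Suc t)
  have "sent_by (Suc (Suc t)) v \<subseteq> sent_by (Suc t) v \<union> known_by (Suc t) v"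
    using next_item_fresh[of "known_by (Suc t) v" "sent_by (Suc t) v"]
    by (subst sent_by.simps(2), cases "item (Suc t) v") (auto simp del: sent_by.simps)
  then show ?case using Suc known_mono[of t "Suc t" v] by (auto simp del: sent_by.simps)
qed

lemma sent_known: "sent_by t v \<subseteq> known_by t v"
  using sent_mono[of t "Suc t" v] sent_Suc_known[of t v] by (auto simp del: sent_by.simps)

lemma known_nbr:
  "(w, v) \<in> E \<Longrightarrow> (e, k) \<in> sent_by t w \<Longrightarrow> (e + a, k) \<in> known_by t v"
  by (auto simp: known_def received_def)

lemma key_dist_nbr: "k \<in> keys \<Longrightarrow> (w, v) \<in> E \<Longrightarrow> key_dist v k \<le> Suc (key_dist w k)"
  unfolding key_dist_def using owner_in by (intro hop_nbr_le) auto

lemma key_dist_pred: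
  assumes "v \<in> V" "k \<in> keys" "key_dist v k = Suc d"
  obtains w where "(w, v) \<in> E" "key_dist w k = d"
  using hop_pred[of "owner k" v d] assms owner_in by (auto simp: key_dist_def)

text \<open>An entry is \<open>a\<close> times the length of the walk that the key has taken, and
  this length is at most the number of rounds. The upper bound serves to limit message
  sizes.\<close>

lemma known_sound:
  "v \<in> V \<Longrightarrow> (e, k) \<in> known_by t v \<Longrightarrow> k \<in> keys \<and> a * key_dist v k \<le> e \<and> e \<le> a * t"
proof (induction t arbitrary: v e k)
  case 0
  then show ?case by (auto simp: known_def received_def keys_def key_dist_def dest: owner)
next
  case (Suc t)
  from Suc.prems(2) consider "e = 0" "k \<in> own v"
    | w e' where "(w, v) \<in> E" "(e', k) \<in> sent_by (Suc t) w" "e = e' + a"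
    by (auto simp: known_def received_def simp del: sent_by.simps)
  then show ?case
  proof cases
    case 1
    then show ?thesis using Suc.prems(1) by (auto simp: keys_def key_dist_def dest: owner)
  next
    case 2
    then have w: "w \<in> V" using E_subset by auto
    have s: "k \<in> keys \<and> a * key_dist w k \<le> e' \<and> e' \<le> a * t"
      using Suc.IH[OF w] 2(2) sent_Suc_known by blast
    have "a * key_dist v k \<le> a * Suc (key_dist w k)"
      using key_dist_nbr[of k w v] s 2 by (intro mult_le_mono2) auto
    then show ?thesis using s 2(3) by auto
  qed
qed

lemma before_trans: "before v x y \<Longrightarrow> before v y z \<Longrightarrow> before v x z"
  unfolding before_def by (rule lex_le_graph_trans)

lemma before_rank:
  assumes "k' \<in> keys" "before v k' k" shows "rank v k' < rank v k"
proof -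
  have "{x \<in> keys. before v x k'} \<subset> {x \<in> keys. before v x k}"
    using assms before_trans[of v _ k' k] unfolding before_def by blast
  then show ?thesis unfolding rank_def using finite_keys by (intro psubset_card_mono) auto
qed

lemma before_total: "k \<noteq> k' \<Longrightarrow> before v k k' \<or> before v k' k"
  by (auto simp: before_def lex_le_pair)

text \<open>One tree edge away from the owner of \<open>k\<close>, the distance of \<open>k\<close>
  grows by exactly one and that of any other key by at most one, so a key preceding \<open>k\<close>
  at \<open>w\<close> still precedes it at \<open>v\<close>. This makes slots increase along tree
  paths, on which both the flood and its time reversal rest.\<close>

lemma before_pred:
  assumes "k \<in> keys" "k' \<in> keys" "(w, v) \<in> E" "key_dist v k = Suc (key_dist w k)" "before w k' k"
  shows "before v k' k"
proof -
  have "a * key_dist v k' \<le> a * key_dist w k' + a"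
    using mult_le_mono2[OF key_dist_nbr[OF assms(2,3)], of a] by simp
  then show ?thesis using assms(4,5) lex_le_shift by (auto simp: before_def)
qed

lemma slot_pred:
  assumes "k \<in> keys" "(w, v) \<in> E" "key_dist v k = Suc (key_dist w k)"
  shows "slot w k < slot v k"
proof -
  have "rank w k \<le> rank v k"
    unfolding rank_def using before_pred[OF assms(1) _ assms(2,3)] finite_keys
    by (intro card_mono) auto
  then show ?thesis using assms by (simp add: slot_def)
qed

definition sent_before :: "nat \<Rightarrow> nat \<Rightarrow> nat \<Rightarrow> nat set" where
  "sent_before t v k = {k' \<in> keys. before v k' k \<and> (a * key_dist v k', k') \<in> sent_by t v}"

text \<open>A node that has not yet sent the final entry of a key has sent final entries of smaller keys
  in all but \<open>key_dist v k\<close> of the rounds so far.  The delicate case is a round wasted on an entry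
  that is not final: it belongs to a strictly closer key, for which the induction
  hypothesis is stronger by one.\<close>

lemma sent_before_bound:
  assumes "v \<in> V" "k \<in> keys" "(a * key_dist v k, k) \<notin> sent_by t v"
  shows "t \<le> key_dist v k + card (sent_before t v k)"
  using assms
proof (induction t arbitrary: v k)
  case 0
  then show ?case by simp
next
  case (Suc t)
  have fin: "finite (sent_before x y z)" for x y z
    using finite_keys by (auto simp: sent_before_def)
  have unsent: "(a * key_dist v k, k) \<notin> sent_by t v" using Suc.prems(3) by auto
  have mono: "sent_before t v k \<subseteq> sent_before (Suc t) v k" by (auto simp: sent_before_def)
  have key: "Suc t \<le> key_dist v k + card (sent_before (Suc t) v k)"
    if "Suc t \<le> key_dist v k + card (sent_before t v k)"
    using that card_mono[OF fin mono] by linarith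
  have closer: ?case
    if k': "(e, k') \<in> known_by t v" "(a * key_dist v k', k') \<notin> sent_by t v"
      "a * key_dist v k' < e" "lex_le (e, k') (a * key_dist v k, k)" for e k'
  proof -
    have kk: "k' \<in> keys" using known_sound[OF Suc.prems(1) k'(1)] by auto
    have lt: "a * key_dist v k' < a * key_dist v k" using k'(3,4) unfolding lex_le_pair by linarith
    then have "key_dist v k' < key_dist v k" by simp
    moreover have "sent_before t v k' \<subseteq> sent_before t v k"
      using lt before_trans[of v _ k' k] by (auto simp: sent_before_def before_def lex_le_pair)
    then have "card (sent_before t v k') \<le> card (sent_before t v k)" by (intro card_mono fin)
    ultimately show ?case using Suc.IH[OF Suc.prems(1) kk k'(2)] by (intro key) linarith
  qed
  show ?case
  proof (cases "\<exists>j\<in>pending (known_by t v) (sent_by t v). lex_le j (a * key_dist v k, k)")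
    case True
    then obtain j where j: "j \<in> pending (known_by t v) (sent_by t v)" "lex_le j (a * key_dist v k, k)"
      by auto
    then obtain e k' where i: "item t v = Some (e, k')"
      using next_item_None[of "known_by t v" "sent_by t v"] by (cases "item t v") auto
    have le: "lex_le (e, k') (a * key_dist v k, k)"
      using next_item_Some(2)[OF i j(1)] j(2) by (auto simp: lex_le_def)
    have pend: "(e, k') \<in> pending (known_by t v) (sent_by t v)" using next_item_Some(1)[OF i] .
    then have kn: "(e, k') \<in> known_by t v" by (auto simp: pending_def)
    then have k': "k' \<in> keys" "a * key_dist v k' \<le> e" using known_sound[OF Suc.prems(1)] by auto
    show ?thesis
    proof (cases "e = a * key_dist v k'")
      case True
      have ne: "k' \<noteq> k" using Suc.prems(3) i True by auto
      have "k' \<in> sent_before (Suc t) v k" using k' ne le i True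
        by (auto simp: sent_before_def before_def)
      moreover have "k' \<notin> sent_before t v k"
        using pend True by (auto simp: sent_before_def pending_def)
      ultimately have "sent_before t v k \<subset> sent_before (Suc t) v k" using mono by auto
      then have "card (sent_before t v k) < card (sent_before (Suc t) v k)"
        by (intro psubset_card_mono fin)
      then show ?thesis using Suc.IH[OF Suc.prems(1,2) unsent] by linarith
    next
      case False
      then have lt: "a * key_dist v k' < e" using k'(2) by simp
      have "(a * key_dist v k', k') \<notin> known_by t v"
        using pend lt by (auto simp: pending_def)
      then show ?thesis using closer[OF kn _ lt le] sent_known by blast
    qed
  next
    case False
    \<comment> \<open>Nothing up to the target entry is pending, so the target has not even arrived.
      The argument moves to a tree predecessor \<open>w\<close>, which cannot have sent it
      yet.\<close>
    have nk: "(a * key_dist v k, k) \<notin> known_by t v"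
    proof
      assume "(a * key_dist v k, k) \<in> known_by t v"
      then have "(a * key_dist v k, k) \<in> pending (known_by t v) (sent_by t v)"
        using unsent known_sound[OF Suc.prems(1)] by (auto simp: pending_def)
      then show False using False by (auto simp: lex_le_def)
    qed
    have "key_dist v k \<noteq> 0"
    proof
      assume "key_dist v k = 0"
      moreover from this have "owner k = v"
        using hop_eq_0[of "owner k" v] owner_in[OF Suc.prems(2)] Suc.prems(1)
        by (auto simp: key_dist_def)
      ultimately show False using nk owner_in[OF Suc.prems(2)] by (auto simp: known_def)
    qed
    then obtain d where d: "key_dist v k = Suc d" using not0_implies_Suc by auto
    then obtain w where w: "(w, v) \<in> E" "key_dist w k = d"
      using key_dist_pred[OF Suc.prems(1,2)] by blast
    have wV: "w \<in> V" using w E_subset by auto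
    have "(a * key_dist w k, k) \<notin> sent_by t w"
      using nk known_nbr[OF w(1), of "a * key_dist w k" k t] d w(2) by (auto simp: algebra_simps)
    then have IHw: "t \<le> d + card (sent_before t w k)"
      using Suc.IH[OF wV Suc.prems(2)] w(2) by simp
    show ?thesis
    proof (cases "sent_before t w k \<subseteq> sent_before t v k")
      case True
      then have "card (sent_before t w k) \<le> card (sent_before t v k)" by (intro card_mono fin)
      then show ?thesis using IHw d by (intro key) linarith
    next
      case False
      \<comment> \<open>Here \<open>w\<close> is ahead of \<open>v\<close> on \<open>k'\<close>. An
        entry of \<open>k'\<close> that is due has reached \<open>v\<close>, yet nothing due is
        pending, so the best entry known to \<open>v\<close> was already sent and is not final: the
        wasted round treated in \<open>closer\<close>.\<close>
      then obtain k' where k': "k' \<in> sent_before t w k" "k' \<notin> sent_before t v k" by auto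
      then have kk: "k' \<in> keys" "before w k' k" "(a * key_dist w k', k') \<in> sent_by t w"
        by (auto simp: sent_before_def)
      then have bv: "before v k' k" using before_pred[OF Suc.prems(2) _ w(1)] d w(2) by auto
      then have uns: "(a * key_dist v k', k') \<notin> sent_by t v"
        using k'(2) kk by (auto simp: sent_before_def)
      have kn: "(a * key_dist w k' + a, k') \<in> known_by t v" using known_nbr[OF w(1) kk(3)] .
      define e where "e = (LEAST e. (e, k') \<in> known_by t v)"
      have e: "(e, k') \<in> known_by t v" unfolding e_def using kn by (rule LeastI)
      have emin: "e \<le> e'" if "(e', k') \<in> known_by t v" for e'
        unfolding e_def using that by (rule Least_le)
      have "e \<le> a * key_dist w k' + a" using emin kn by blast
      then have le: "lex_le (e, k') (a * key_dist v k, k)"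
        using kk(2) d w(2) lex_le_shift by (auto simp: before_def)
      have "(e, k') \<in> sent_by t v"
        using \<open>\<not> (\<exists>j\<in>pending (known_by t v) (sent_by t v). lex_le j (a * key_dist v k, k))\<close> e emin le
        by (auto simp: pending_def)
      then have "e \<noteq> a * key_dist v k'" using uns by auto
      then have "a * key_dist v k' < e" using known_sound[OF Suc.prems(1) e] by simp
      then show ?thesis using closer[OF e uns _ le] by blast
    qed
  qed
qed

lemma sent_slot:
  assumes "v \<in> V" "k \<in> keys" "slot v k < t"
  shows "(a * key_dist v k, k) \<in> sent_by t v"
proof (rule ccontr)
  assume "(a * key_dist v k, k) \<notin> sent_by t v"
  then have "t \<le> key_dist v k + card (sent_before t v k)" using sent_before_bound assms by blast
  moreover have "card (sent_before t v k) \<le> rank v k"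
    unfolding rank_def sent_before_def using finite_keys by (intro card_mono) auto
  ultimately show False using assms(3) by (simp add: slot_def)
qed

lemma known_slot:
  assumes "v \<in> V" "k \<in> keys" "slot v k \<le> t"
  shows "(a * key_dist v k, k) \<in> known_by t v"
  using sent_slot[of v k "Suc t"] sent_Suc_known[of t v] assms by (auto simp del: sent_by.simps)

end

section \<open>Detecting quiescence\<close>

context network
begin

definition diam :: nat where "diam = Max {hop u v |u v. u \<in> V \<and> v \<in> V}"

lemma finite_hops: "finite {hop u v |u v. u \<in> V \<and> v \<in> V}"
proof -
  have "{hop u v |u v. u \<in> V \<and> v \<in> V} = (\<lambda>(u, v). hop u v) ` (V \<times> V)" by auto
  then show ?thesis using finite_V by simp
qed

lemma hop_le_diam: "u \<in> V \<Longrightarrow> v \<in> V \<Longrightarrow> hop u v \<le> diam"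
  unfolding diam_def using finite_hops by (intro Max_ge) auto

lemma finite_nbrs: "finite {w. (w, v) \<in> E}" "finite {w. (v, w) \<in> E}"
  using E_subset finite_V by (auto intro: finite_subset)

primrec max_id :: "nat \<Rightarrow> nat \<Rightarrow> nat" where
  "max_id 0 v = v"
| "max_id (Suc t) v = Max (insert (max_id t v) (max_id t ` {w. (w, v) \<in> E}))"

lemma max_id_in: "v \<in> V \<Longrightarrow> max_id t v \<in> V \<and> hop (max_id t v) v \<le> t"
proof (induction t arbitrary: v)
  case (Suc t)
  have "max_id (Suc t) v \<in> insert (max_id t v) (max_id t ` {w. (w, v) \<in> E})"
    unfolding max_id.simps using finite_nbrs by (intro Max_in) auto
  then consider "max_id (Suc t) v = max_id t v" | w where "(w, v) \<in> E" "max_id (Suc t) v = max_id t w"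
    by auto
  then show ?case
  proof cases
    case 1
    then show ?thesis using Suc.IH[OF Suc.prems] by simp
  next
    case 2
    then have "w \<in> V" using E_subset by auto
    then show ?thesis using 2 Suc.IH[of w] hop_nbr_le[of "max_id t w" w v] by simp
  qed
qed auto

lemma max_id_ge: "u \<in> V \<Longrightarrow> v \<in> V \<Longrightarrow> hop u v \<le> t \<Longrightarrow> u \<le> max_id t v"
proof (induction t arbitrary: v)
  case 0
  then show ?case using hop_eq_0 by auto
next
  case (Suc t)
  show ?case
  proof (cases "hop u v \<le> t")
    case True
    then have "u \<le> max_id t v" using Suc by auto
    also have "\<dots> \<le> max_id (Suc t) v" unfolding max_id.simps using finite_nbrs by (intro Max_ge) auto
    finally show ?thesis .
  next
    case False
    then have "hop u v = Suc t" using Suc.prems by auto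
    then obtain w where w: "(w, v) \<in> E" "hop u w = t" using hop_pred Suc.prems by metis
    then have "u \<le> max_id t w" using Suc.IH[of w] Suc.prems E_subset by auto
    also have "\<dots> \<le> max_id (Suc t) v"
      unfolding max_id.simps using finite_nbrs w(1) by (intro Max_ge) auto
    finally show ?thesis .
  qed
qed

lemma max_id_final: "v \<in> V \<Longrightarrow> diam \<le> t \<Longrightarrow> max_id t v = Max V"
  using max_id_ge[of "Max V" v t] max_id_in[of v t] hop_le_diam[of "Max V" v] finite_V V_nonempty
  by (metis Max_ge Max_in le_antisym le_trans)

end

context flooding
begin

definition changed :: "nat \<Rightarrow> nat \<Rightarrow> bool" where
  "changed t v \<longleftrightarrow> max_id (Suc t) v \<noteq> max_id t v \<or> sent_by (Suc t) v \<noteq> sent_by t v"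

text \<open>A change in round \<open>s\<close> is recorded as \<open>Suc s\<close>, which leaves
  \<open>0\<close> for having heard of no change.\<close>

primrec last_change :: "nat \<Rightarrow> nat \<Rightarrow> nat" where
  "last_change 0 v = 0"
| "last_change (Suc t) v =
     (if changed t v then Suc t
      else Max (insert (last_change t v) (last_change t ` {w. (w, v) \<in> E})))"

lemma last_change_le: "last_change t v \<le> t"
proof (induction t arbitrary: v)
  case (Suc t)
  then show ?case using finite_nbrs by (auto simp: le_SucI)
qed auto

lemma last_change_step:
  "last_change t v \<le> last_change (Suc t) v"
  "(w, v) \<in> E \<Longrightarrow> last_change t w \<le> last_change (Suc t) v"
  using last_change_le[of t v] last_change_le[of t w] finite_nbrs
  by (auto intro: le_SucI Max_ge)

lemma last_change_ge:
  "w \<in> V \<Longrightarrow> v \<in> V \<Longrightarrow> changed s w \<Longrightarrow> Suc s + hop w v \<le> t \<Longrightarrow> Suc s \<le> last_change t v"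
proof (induction t arbitrary: v)
  case (Suc t)
  consider "Suc s + hop w v \<le> t" | "t = s" "w = v" | d where "hop w v = Suc d" "Suc s + d = t"
    using Suc.prems hop_eq_0[of w v] by (cases "hop w v") (auto simp: le_Suc_eq)
  then show ?case
  proof cases
    case 1
    then show ?thesis using Suc last_change_step(1)[of t v] by fastforce
  next
    case 2
    then show ?thesis using Suc.prems by simp
  next
    case 3
    then obtain u where u: "(u, v) \<in> E" "hop w u = d" using hop_pred Suc.prems by metis
    then have "Suc s \<le> last_change t u" using Suc 3 E_subset by auto
    then show ?thesis using last_change_step(2)[OF u(1), of t] by linarith
  qed
qed auto

lemma last_change_sound:
  "v \<in> V \<Longrightarrow> last_change t v = Suc s \<Longrightarrow> \<exists>w\<in>V. changed s w"
proof (induction t arbitrary: v)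
  case (Suc t)
  show ?case
  proof (cases "changed t v")
    case True
    then show ?thesis using Suc.prems by auto
  next
    case False
    then have "Suc s \<in> insert (last_change t v) (last_change t ` {w. (w, v) \<in> E})"
      using Suc.prems(2) finite_nbrs Max_in[of "insert (last_change t v) (last_change t ` {w. (w, v) \<in> E})"]
      by auto
    then show ?thesis using Suc.IH Suc.prems(1) E_subset by force
  qed
qed auto

text \<open>The next values of \<open>v\<close> depend only on current values in its neighbourhood.
  If nobody changed in round \<open>s\<close>, everybody repeats the same computation in round
  \<open>s + 1\<close>.\<close>

lemma quiet_step:
  assumes "\<And>w. w \<in> V \<Longrightarrow> \<not> changed s w" "v \<in> V"
  shows "\<not> changed (Suc s) v"
proof -
  have eq: "max_id (Suc s) w = max_id s w" "sent_by (Suc s) w = sent_by s w" if "w \<in> V" for w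
    using assms(1)[OF that] by (auto simp: changed_def)
  have nb: "w \<in> V" if "(w, v) \<in> E" for w using that E_subset by auto
  have "max_id (Suc s) ` {w. (w, v) \<in> E} = max_id s ` {w. (w, v) \<in> E}"
    using eq nb by (intro image_cong) auto
  then have 1: "max_id (Suc (Suc s)) v = max_id (Suc s) v"
    using eq[OF assms(2)] by (simp del: max_id.simps add: max_id.simps(2)[of "Suc s"] max_id.simps(2)[of s])
  have "received (sent_by (Suc s)) v = received (sent_by s) v"
    using eq nb by (fastforce simp: received_def simp del: sent_by.simps)
  then have 2: "sent_by (Suc (Suc s)) v = sent_by (Suc s) v"
    using eq[OF assms(2)] by (simp del: sent_by.simps add: sent_by.simps(2)[of "Suc s"] sent_by.simps(2)[of s])
  show ?thesis using 1 2 by (simp add: changed_def del: max_id.simps sent_by.simps)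
qed

definition quiet_time :: nat where "quiet_time = (LEAST s. \<forall>w\<in>V. \<not> changed s w)"

lemma quiet_after:
  assumes "\<forall>w\<in>V. \<not> changed s w" "s \<le> t" "v \<in> V" shows "\<not> changed t v"
  using assms(2,3)
proof (induction t arbitrary: v rule: dec_induct)
  case base
  then show ?case using assms(1) by auto
next
  case (step t)
  then show ?case using quiet_step[of t v] by blast
qed

lemma changed_before: "s < quiet_time \<Longrightarrow> \<exists>w\<in>V. changed s w"
  unfolding quiet_time_def using not_less_Least by blast

text \<open>If \<open>v\<close> has heard of no change after round \<open>s\<close> and \<open>3 s + 2\<close> rounds have passed, then the ball of
  radius \<open>s\<close> around the largest identifier known to \<open>v\<close> is the whole graph: otherwise the flood of
  that identifier, or of a larger one, would have caused a change that \<open>v\<close> has had time to notice.\<close>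

lemma quiet_detect:
  assumes "v \<in> V" "3 * last_change t v + 2 \<le> t"
  shows "\<forall>w\<in>V. \<not> changed (last_change t v) w"
proof -
  define s where "s = last_change t v"
  have s: "3 * s + 2 \<le> t" using assms(2) by (simp add: s_def)
  have no: "\<not> changed s' w" if "s \<le> s'" "w \<in> V" "Suc s' + hop w v \<le> t" for s' w
    using last_change_ge[OF that(2) assms(1) _ that(3)] that(1) by (auto simp: s_def)
  have const: "max_id t' v = max_id s v" if "s \<le> t'" "t' \<le> t" for t'
    using that
  proof (induction t' rule: dec_induct)
    case (step t')
    then show ?case using no[of t' v] assms(1) by (auto simp: changed_def simp del: max_id.simps)
  qed auto
  define z where "z = max_id s v"
  have zt: "max_id t v = z" using const[of t] s by (simp add: z_def)
  have z: "z \<in> V" "hop z v \<le> s" using max_id_in[OF assms(1), of s] by (auto simp: z_def)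
  have close: "hop z w \<le> s" if wV: "w \<in> V" for w
  proof (rule ccontr)
    assume "\<not> hop z w \<le> s"
    then obtain x where x: "x \<in> V" "hop z x = Suc s"
      using hop_intermediate[OF z(1) wV, of "Suc s"] by auto
    have xv: "hop x v \<le> Suc s + s"
      using hop_triangle[of x z v] hop_sym[of x z] x z assms(1) by auto
    \<comment> \<open>The origin of the threshold: a change at \<open>x\<close> in round
      \<open>s\<close> is counted as \<open>s + 1\<close> and needs at most \<open>2 s + 1\<close>
      hops to \<open>v\<close>, hence is noticed by round \<open>3 s + 2\<close>. The identifier
      \<open>y\<close> below needs at most \<open>3 s + 1\<close> hops.\<close>
    then have "\<not> changed s x" using no[of s x] x s by auto
    then have eq: "max_id (Suc s) x = max_id s x" by (auto simp: changed_def)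
    define y where "y = max_id s x"
    have y: "y \<in> V" "hop y x \<le> s" using max_id_in[OF x(1), of s] by (auto simp: y_def)
    have "z \<le> y" using max_id_ge[of z x "Suc s"] x z eq by (simp add: y_def)
    moreover have "y \<noteq> z" using y x by auto
    moreover have "y \<le> z"
      using max_id_ge[of y v t] hop_triangle[of y x v] y x xv s assms(1) zt by auto
    ultimately show False by simp
  qed
  show ?thesis
  proof
    fix w assume w: "w \<in> V"
    have "hop w v \<le> s + s"
      using hop_triangle[of w z v] hop_sym[of w z] close[OF w] w z assms(1) by auto
    then show "\<not> changed (last_change t v) w" using no[of s w] w s by (auto simp: s_def)
  qed
qed

end

section \<open>The first flood: broadcast of keys and its simultaneous end\<close>

locale gathering = flooding V E 0 own owner for V E own owner
begin

lemma sent_final: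
  assumes "v \<in> V" "diam + card keys \<le> t" shows "sent_by t v = {0} \<times> keys"
proof -
  have "sent_by t v \<subseteq> {0} \<times> keys" using sent_known[of t v] known_sound[OF assms(1)] by fastforce
  moreover have "(0, k) \<in> sent_by t v" if "k \<in> keys" for k
  proof -
    have "slot v k < t"
      using rank_less[OF that, of v] hop_le_diam[of "owner k" v] owner_in[OF that] assms
      by (simp add: slot_def key_dist_def)
    then show ?thesis using sent_slot[OF assms(1) that] by simp
  qed
  ultimately show ?thesis by auto
qed

lemma quiet_eventually: "v \<in> V \<Longrightarrow> diam + card keys \<le> t \<Longrightarrow> \<not> changed t v"
  using sent_final[of v t] sent_final[of v "Suc t"] max_id_final[of v t] max_id_final[of v "Suc t"]
  by (simp add: changed_def del: sent_by.simps max_id.simps)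

lemma quiet_time_le: "quiet_time \<le> diam + card keys"
  unfolding quiet_time_def using quiet_eventually by (intro Least_le) auto

lemma quiet: "v \<in> V \<Longrightarrow> quiet_time \<le> t \<Longrightarrow> \<not> changed t v"
  by (rule quiet_after[of quiet_time])
    (use LeastI[of "\<lambda>s. \<forall>w\<in>V. \<not> changed s w" "diam + card keys"] quiet_eventually in
      \<open>auto simp: quiet_time_def\<close>)

lemma max_id_quiet:
  assumes "v \<in> V" "quiet_time \<le> t" shows "max_id t v = Max V"
proof -
  have "max_id t' v = max_id t v" if "t \<le> t'" for t'
    using that
  proof (induction t' rule: dec_induct)
    case (step t')
    then show ?case using quiet[of v t'] assms by (auto simp: changed_def simp del: max_id.simps)
  qed auto
  from this[of "t + diam"] show ?thesis using max_id_final[OF assms(1), of "t + diam"] by simp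
qed

lemma sent_quiet:
  assumes "v \<in> V" "quiet_time \<le> t" shows "sent_by t v = {0} \<times> keys"
proof -
  have "sent_by t' v = sent_by t v" if "t \<le> t'" for t'
    using that
  proof (induction t' rule: dec_induct)
    case (step t')
    then show ?case using quiet[of v t'] assms by (auto simp: changed_def simp del: sent_by.simps)
  qed auto
  from this[of "t + (diam + card keys)"] show ?thesis
    using sent_final[OF assms(1), of "t + (diam + card keys)"] by simp
qed

text \<open>By the quiet time every node holds \<open>Max V\<close>, so it lies within that many
  hops of \<open>Max V\<close>; two such legs join any two nodes.\<close>

lemma hop_le_quiet: "u \<in> V \<Longrightarrow> v \<in> V \<Longrightarrow> hop u v \<le> 2 * quiet_time"
proof -
  have M: "Max V \<in> V" using finite_V V_nonempty by simp
  have a: "hop (Max V) w \<le> quiet_time" if "w \<in> V" for w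
    using max_id_in[OF that, of quiet_time] max_id_quiet[OF that] by auto
  assume "u \<in> V" "v \<in> V"
  then show ?thesis using hop_triangle[of u "Max V" v] hop_sym[of u "Max V"] a[of u] a[of v] M by auto
qed

lemma last_change_le_quiet: "v \<in> V \<Longrightarrow> last_change t v \<le> quiet_time"
proof (cases "last_change t v")
  case (Suc s)
  moreover assume "v \<in> V"
  ultimately show ?thesis using last_change_sound[of v t s] quiet[of _ s] by (auto simp: not_less_eq_eq[symmetric])
qed simp

lemma last_change_final:
  assumes "v \<in> V" "3 * quiet_time \<le> t" shows "last_change t v = quiet_time"
proof (cases quiet_time)
  case 0
  then show ?thesis using last_change_le_quiet[OF assms(1), of t] by simp
next
  case (Suc s)
  then obtain w where w: "w \<in> V" "changed s w" using changed_before[of s] by auto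
  have "quiet_time \<le> last_change t v"
    using last_change_ge[OF w(1) assms(1) w(2), of t] hop_le_quiet[OF w(1) assms(1)] assms(2) Suc by auto
  then show ?thesis using last_change_le_quiet[OF assms(1), of t] by simp
qed

text \<open>No node stops early, since a local detection implies that the network is quiet from
  \<open>last_change\<close> on. No node stops late: the last change happened in round
  \<open>quiet_time - 1\<close> and has at most \<open>2 * quiet_time\<close> hops to travel, so
  everybody knows it after \<open>3 * quiet_time\<close> rounds. Hence all nodes switch phase in the
  same round without further synchronisation.\<close>

lemma detect_iff:
  assumes "v \<in> V"
  shows "3 * last_change t v + 2 \<le> t \<longleftrightarrow> 3 * quiet_time + 2 \<le> t"
proof
  assume l: "3 * last_change t v + 2 \<le> t"
  then have "quiet_time \<le> last_change t v"
    unfolding quiet_time_def using quiet_detect[OF assms l] by (intro Least_le)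
  then show "3 * quiet_time + 2 \<le> t" using l by simp
next
  assume "3 * quiet_time + 2 \<le> t"
  then show "3 * last_change t v + 2 \<le> t" using last_change_final[OF assms, of t] by simp
qed

end

section \<open>Buying shortest-path trees\<close>

context network
begin

text \<open>Choosing the least candidate fixes one tree per root and lets \<open>v\<close> compute
  its parent from the entries that its neighbours have sent.\<close>

definition par :: "nat \<Rightarrow> nat \<Rightarrow> nat" where
  "par v k = (LEAST w. (w, v) \<in> E \<and> Suc (hop k w) = hop k v)"

abbreviation anc :: "nat \<Rightarrow> nat \<Rightarrow> nat \<Rightarrow> nat" where
  "anc k i \<equiv> (\<lambda>v. par v k) ^^ i"

definition nbrs :: "nat \<Rightarrow> nat set" where "nbrs v = {w. (v, w) \<in> E}"

definition high_anc :: "nat \<Rightarrow> nat \<Rightarrow> nat \<Rightarrow> nat \<Rightarrow> nat set" where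
  "high_anc h k x m = {anc k i x |i. i < m \<and> h \<le> card (nbrs (anc k i x))}"

lemma par_props:
  assumes "k \<in> V" "v \<in> V" "v \<noteq> k"
  shows "(par v k, v) \<in> E" "Suc (hop k (par v k)) = hop k v" "par v k \<in> V"
proof -
  have "hop k v \<noteq> 0" using hop_eq_0 assms by auto
  then obtain d where d: "hop k v = Suc d" using not0_implies_Suc by auto
  then have ex: "\<exists>w. (w, v) \<in> E \<and> Suc (hop k w) = hop k v" using hop_pred assms by metis
  show 1: "(par v k, v) \<in> E" and "Suc (hop k (par v k)) = hop k v"
    using LeastI_ex[OF ex] by (auto simp: par_def)
  show "par v k \<in> V" using 1 E_subset by auto
qed

lemma anc_props:
  assumes "k \<in> V" "x \<in> V" "i \<le> hop k x"
  shows "anc k i x \<in> V \<and> hop k (anc k i x) + i = hop k x"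
  using assms(3)
proof (induction i)
  case 0
  then show ?case using assms by simp
next
  case (Suc i)
  then have IH: "anc k i x \<in> V" "hop k (anc k i x) + i = hop k x" by auto
  then have "anc k i x \<noteq> k" using Suc.prems by auto
  then show ?case using par_props[OF assms(1) IH(1)] IH(2) by auto
qed

lemma finite_high_anc: "finite (high_anc h k x m)"
  unfolding high_anc_def by simp

lemma high_anc_subset: "k \<in> V \<Longrightarrow> x \<in> V \<Longrightarrow> m \<le> hop k x \<Longrightarrow> high_anc h k x m \<subseteq> V"
  using anc_props by (auto simp: high_anc_def)

lemma finite_nbrs': "finite (nbrs v)"
  by (simp add: nbrs_def finite_nbrs)

lemma hop_diff_nbr: "k \<in> V \<Longrightarrow> (v, w) \<in> E \<Longrightarrow> hop k w \<le> Suc (hop k v) \<and> hop k v \<le> Suc (hop k w)"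
  using hop_nbr_le[of k v w] hop_nbr_le[of k w v] E_sym by auto

text \<open>The ancestors of a node have distinct distances to the root, so every node is adjacent to
  at most three of them.\<close>

lemma card_nbrs_high_anc:
  assumes "k \<in> V" "x \<in> V" "m \<le> hop k x"
  shows "h * card (high_anc h k x m) \<le> 3 * card (\<Union>v\<in>high_anc h k x m. nbrs v)"
proof -
  define W where "W = high_anc h k x m"
  define Y where "Y = (\<Union>v\<in>W. nbrs v)"
  have fW: "finite W" and WV: "W \<subseteq> V"
    using finite_high_anc high_anc_subset[OF assms] by (auto simp: W_def)
  have fY: "finite Y" using fW finite_nbrs' by (auto simp: Y_def)
  have inj: "inj_on (hop k) W"
  proof (rule inj_onI)
    fix v w assume "v \<in> W" "w \<in> W" and eq: "hop k v = hop k w"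
    then obtain i j where ij: "v = anc k i x" "w = anc k j x" "i < m" "j < m"
      by (auto simp: W_def high_anc_def)
    then have "i = j" using anc_props[OF assms(1,2), of i] anc_props[OF assms(1,2), of j] eq assms(3)
      by auto
    then show "v = w" using ij by simp
  qed
  have few: "card {v \<in> W. y \<in> nbrs v} \<le> 3" for y
  proof -
    have "hop k ` {v \<in> W. y \<in> nbrs v} \<subseteq> {hop k y - 1..hop k y + 1}"
      using hop_diff_nbr[OF assms(1)] by (fastforce simp: nbrs_def)
    then have "card (hop k ` {v \<in> W. y \<in> nbrs v}) \<le> card {hop k y - 1..hop k y + 1}"
      by (intro card_mono) auto
    also have "\<dots> \<le> 3" by simp
    finally show ?thesis using card_image[OF inj_on_subset[OF inj, of "{v \<in> W. y \<in> nbrs v}"]] by auto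
  qed
  have "h * card W = (\<Sum>v\<in>W. h)" by simp
  also have "\<dots> \<le> (\<Sum>v\<in>W. card (nbrs v))"
    by (intro sum_mono) (auto simp: W_def high_anc_def)
  also have "\<dots> = (\<Sum>v\<in>W. card {y \<in> Y. y \<in> nbrs v})"
    by (intro sum.cong refl arg_cong[where f = card]) (auto simp: Y_def)
  also have "\<dots> = (\<Sum>v\<in>W. \<Sum>y\<in>Y. if y \<in> nbrs v then 1 else 0)"
    using fY by (simp add: sum.If_cases Int_def)
  also have "\<dots> = (\<Sum>y\<in>Y. \<Sum>v\<in>W. if y \<in> nbrs v then 1 else 0)" by (rule sum.swap)
  also have "\<dots> = (\<Sum>y\<in>Y. card {v \<in> W. y \<in> nbrs v})"
    using fW by (simp add: sum.If_cases Int_def)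
  also have "\<dots> \<le> (\<Sum>y\<in>Y. 3)" by (intro sum_mono few)
  finally show ?thesis by (simp add: W_def Y_def)
qed

end

section \<open>Which tree edges are bought, their stretch and their number\<close>

locale marking = network V E for V E +
  fixes T S :: "nat set" and P :: "(nat \<times> nat) set"
  assumes T_subset: "T \<subseteq> V" and S_subset: "S \<subseteq> V"
    and P_T: "(u, v) \<in> P \<Longrightarrow> u \<in> T \<and> v \<in> T"
begin

sublocale flooding V E 1 "\<lambda>v. {v} \<inter> (T \<union> S)" "\<lambda>k. k"
  by unfold_locales auto

lemma keys_eq: "keys = T \<union> S"
  using T_subset S_subset by (auto simp: keys_def)

lemma key_dist_eq: "key_dist v k = hop k v"
  by (simp add: key_dist_def)

definition hit :: "nat \<Rightarrow> bool" where "hit v \<longleftrightarrow> (\<exists>s\<in>S. hop s v \<le> 1)"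

definition partner :: "nat \<Rightarrow> nat \<Rightarrow> bool" where
  "partner v k \<longleftrightarrow> (k, v) \<in> P \<or> (v, k) \<in> P"

text \<open>\<open>buy v k\<close> means that \<open>v\<close> buys the edge to its parent in the
  tree rooted at \<open>k\<close>. As \<open>partner\<close> is symmetric, both ends of a pair start
  a walk, whence the factor 2 in \<open>num_bought_le\<close>.\<close>

inductive buy :: "nat \<Rightarrow> nat \<Rightarrow> bool" where
  all: "k \<in> S \<Longrightarrow> v \<in> V \<Longrightarrow> v \<noteq> k \<Longrightarrow> buy v k"
| pair: "partner v k \<Longrightarrow> v \<noteq> k \<Longrightarrow> \<not> hit v \<Longrightarrow> buy v k"
| child: "buy z k \<Longrightarrow> par z k \<noteq> k \<Longrightarrow> \<not> hit (par z k) \<Longrightarrow> buy (par z k) k"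

lemma partner_in: "partner v k \<Longrightarrow> v \<in> T \<and> k \<in> T"
  using P_T by (auto simp: partner_def)

lemma buy_in: "buy v k \<Longrightarrow> v \<in> V \<and> k \<in> T \<union> S \<and> v \<noteq> k"
proof (induction rule: buy.induct)
  case (child z k)
  then show ?case using par_props(3)[of k z] T_subset S_subset by auto
qed (use partner_in T_subset S_subset in auto)

definition bought :: "(nat \<times> nat) set" where
  "bought = {(v, par v k) |v k. buy v k} \<union> {(par v k, v) |v k. buy v k}"

lemma bought_subset: "bought \<subseteq> E"
proof -
  have "(par v k, v) \<in> E" if "buy v k" for v k
    using par_props(1)[of k v] buy_in[OF that] T_subset S_subset by auto
  then show ?thesis using E_sym by (auto simp: bought_def)
qed

lemma bought_sym: "(u, v) \<in> bought \<Longrightarrow> (v, u) \<in> bought"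
  by (auto simp: bought_def)

lemma bought_relpow_sym: "(u, v) \<in> bought ^^ n \<Longrightarrow> (v, u) \<in> bought ^^ n"
proof (induction n arbitrary: v)
  case (Suc n)
  then obtain w where "(u, w) \<in> bought ^^ n" "(w, v) \<in> bought" by auto
  then show ?case using Suc.IH[of w] bought_sym[of w v] by (metis relpow_Suc_I2)
qed auto

lemma bought_tree:
  assumes "s \<in> S" "v \<in> V" shows "(v, s) \<in> bought ^^ hop s v"
  using assms(2)
proof (induction "hop s v" arbitrary: v)
  case 0
  then show ?case using hop_eq_0[of s v] S_subset assms(1) by auto
next
  case (Suc d)
  then have ne: "v \<noteq> s" by auto
  have sV: "s \<in> V" using S_subset assms(1) by auto
  have "(v, par v s) \<in> bought" using buy.all[OF assms(1) Suc.prems ne] by (auto simp: bought_def)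
  moreover have "(par v s, s) \<in> bought ^^ d"
    using Suc.hyps(1)[of "par v s"] par_props[OF sV Suc.prems ne] Suc.hyps(2)
    by (metis Suc_inject)
  ultimately show ?case using Suc.hyps(2) by (metis relpow_Suc_I2)
qed

text \<open>The third assumption is the invariant of the walk: a node that is not hit and is a
  partner, or was reached from a buying child, buys its own parent edge and thereby passes the
  assumption on to its parent.\<close>

lemma walk_to_root_or_hit:
  assumes "v \<in> V" "k \<in> V" "partner v k \<or> (\<exists>z. buy z k \<and> par z k = v)"
  shows "(v, k) \<in> bought ^^ hop k v \<or>
    (\<exists>w\<in>V. \<exists>i. (v, w) \<in> bought ^^ i \<and> i + hop k w = hop k v \<and> hit w)"
  using assms(1,3)
proof (induction "hop k v" arbitrary: v)
  case 0
  then show ?case using hop_eq_0[of k v] assms(2) by auto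
next
  case (Suc d)
  show ?case
  proof (cases "hit v")
    case True
    then show ?thesis using Suc.prems(1) by (intro disjI2 bexI[of _ v] exI[of _ 0]) auto
  next
    case False
    have ne: "v \<noteq> k" using Suc.hyps(2) by auto
    then have b: "buy v k" using Suc.prems(2) False buy.pair buy.child by metis
    then have e: "(v, par v k) \<in> bought" by (auto simp: bought_def)
    note pr = par_props[OF assms(2) Suc.prems(1) ne]
    have d: "d = hop k (par v k)" using pr(2) Suc.hyps(2) by simp
    have "(par v k, k) \<in> bought ^^ hop k (par v k) \<or>
      (\<exists>w\<in>V. \<exists>i. (par v k, w) \<in> bought ^^ i \<and> i + hop k w = hop k (par v k) \<and> hit w)"
      using Suc.hyps(1)[OF d pr(3)] b by blast
    then show ?thesis
    proof
      assume "(par v k, k) \<in> bought ^^ hop k (par v k)"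
      then have "(v, k) \<in> bought ^^ Suc (hop k (par v k))" using e by (metis relpow_Suc_I2)
      then show ?thesis using pr(2) by simp
    next
      assume "\<exists>w\<in>V. \<exists>i. (par v k, w) \<in> bought ^^ i \<and> i + hop k w = hop k (par v k) \<and> hit w"
      then obtain w i where w: "w \<in> V" "(par v k, w) \<in> bought ^^ i" "i + hop k w = hop k (par v k)" "hit w"
        by auto
      then have "(v, w) \<in> bought ^^ Suc i" using e by (metis relpow_Suc_I2)
      then show ?thesis using w pr(2) by (intro disjI2 bexI[of _ w] exI[of _ "Suc i"]) auto
    qed
  qed
qed

lemma bought_stretch:
  assumes "(u, v) \<in> P"
  shows "\<exists>n \<le> hop u v + 2. (u, v) \<in> bought ^^ n"
proof -
  have V: "u \<in> V" "v \<in> V" using P_T[OF assms] T_subset by auto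
  have "partner v u" using assms by (simp add: partner_def)
  then consider "(v, u) \<in> bought ^^ hop u v"
    | w i where "w \<in> V" "(v, w) \<in> bought ^^ i" "i + hop u w = hop u v" "hit w"
    using walk_to_root_or_hit[OF V(2,1)] by blast
  then show ?thesis
  proof cases
    case 1
    then show ?thesis using bought_relpow_sym by (intro exI[of _ "hop u v"]) auto
  next
    case 2
    then obtain s where s: "s \<in> S" "hop s w \<le> 1" "s \<in> V" using S_subset by (auto simp: hit_def)
    have "(v, w) \<in> bought ^^ i" "(w, s) \<in> bought ^^ hop s w" "(s, u) \<in> bought ^^ hop s u"
      using 2 bought_tree[OF s(1)] V bought_relpow_sym by auto
    then have "(v, u) \<in> bought ^^ (i + (hop s w + hop s u))"
      by (auto simp: relpow_add)
    then have "(u, v) \<in> bought ^^ (i + (hop s w + hop s u))" by (rule bought_relpow_sym)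
    moreover have "hop s u \<le> hop s w + hop u w"
      using hop_triangle[of s w u] hop_sym[of w u] 2 s V by auto
    then have "i + (hop s w + hop s u) \<le> hop u v + 2" using s 2 by linarith
    ultimately show ?thesis by blast
  qed
qed

text \<open>Charges a purchase outside the trees of the centers to a pair: tracing the rule
  \<open>child\<close> backwards ends at a partner \<open>x\<close>, and no node on the way from
  \<open>x\<close> to \<open>v\<close> was hit.\<close>

lemma buy_path:
  assumes "buy v k" "k \<notin> S"
  shows "\<exists>x i. partner x k \<and> i < hop k x \<and> v = anc k i x \<and> (\<forall>j\<le>i. \<not> hit (anc k j x))"
  using assms
proof (induction rule: buy.induct)
  case (pair v k)
  then have "hop k v \<noteq> 0" using hop_eq_0[of k v] partner_in[of v k] T_subset by auto
  then show ?case using pair by (intro exI[of _ v] exI[of _ 0]) auto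
next
  case (child z k)
  then obtain x i where x: "partner x k" "i < hop k x" "z = anc k i x" "\<forall>j\<le>i. \<not> hit (anc k j x)" by auto
  have V: "k \<in> V" "x \<in> V" using partner_in[OF x(1)] T_subset by auto
  have "Suc i \<noteq> hop k x"
  proof
    assume "Suc i = hop k x"
    then have "hop k (anc k (Suc i) x) = 0" "anc k (Suc i) x \<in> V"
      using anc_props[OF V, of "Suc i"] by auto
    then show False using hop_eq_0[of k "anc k (Suc i) x"] V child(2) x(3) by auto
  qed
  then show ?case using x child(3) by (intro exI[of _ x] exI[of _ "Suc i"]) (auto simp: le_Suc_eq)
qed auto

definition num_bought :: nat where
  "num_bought = card {{u, v} |u v. (u, v) \<in> bought}"

lemma bought_edges: "{{u, v} |u v. (u, v) \<in> bought} = {{v, par v k} |v k. buy v k}"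
  by (auto simp: bought_def insert_commute)

lemma num_bought_all:
  assumes "T \<subseteq> S" shows "num_bought \<le> card V * card S"
proof -
  have "{{v, par v k} |v k. buy v k} \<subseteq> (\<lambda>(v, k). {v, par v k}) ` (V \<times> S)"
    using buy_in assms by fastforce
  then have "num_bought \<le> card (V \<times> S)"
    unfolding num_bought_def bought_edges
    using finite_V finite_subset[OF S_subset] by (intro surj_card_le) auto
  then show ?thesis by (simp add: card_cartesian_product)
qed

lemma num_bought_le:
  assumes finP: "finite P"
    and good: "\<And>k x m. k \<in> V \<Longrightarrow> x \<in> V \<Longrightarrow> m \<le> hop k x \<Longrightarrow> l \<le> card (high_anc h k x m) \<Longrightarrow>
      \<exists>v\<in>high_anc h k x m. hit v"
  shows "num_bought \<le> card V * card S + card V * h + 2 * card P * (l - 1)"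
proof -
  \<comment> \<open>Purchases are split by cause. \<open>A1\<close> holds the trees of the centers.
    \<open>A2\<close> holds edges at nodes of degree below \<open>h\<close>, fewer than
    \<open>h\<close> for each. \<open>A3\<close> holds those of high-degree nodes on unhit initial
    parts of tree paths, fewer than \<open>l\<close> for each oriented pair.\<close>
  define A1 where "A1 = (\<lambda>(v, k). {v, par v k}) ` (V \<times> S)"
  define A2 where "A2 = (\<Union>v\<in>{v \<in> V. card (nbrs v) < h}. (\<lambda>w. {v, w}) ` nbrs v)"
  define L where "L x k = {v. \<exists>i<hop k x. v = anc k i x \<and> (\<forall>j\<le>i. \<not> hit (anc k j x)) \<and> h \<le> card (nbrs v)}" for x k
  define A3 where "A3 = (\<Union>(x, k)\<in>P \<union> P\<inverse>. (\<lambda>v. {v, par v k}) ` L x k)"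
  have PV: "x \<in> V \<and> k \<in> V" if "(x, k) \<in> P \<union> P\<inverse>" for x k
    using that P_T T_subset by fastforce
  have L: "finite (L x k) \<and> card (L x k) \<le> l - 1" if "(x, k) \<in> P \<union> P\<inverse>" for x k
  proof -
    define I where "I = {i. i < hop k x \<and> (\<forall>j\<le>i. \<not> hit (anc k j x))}"
    define m where "m = card I"
    have finI: "finite I" by (auto simp: I_def)
    have down: "j \<in> I" if "i \<in> I" "j \<le> i" for i j using that by (auto simp: I_def)
    \<comment> \<open>The unhit positions are closed downwards, hence an initial segment. So
      \<open>L x k\<close> is a \<open>high_anc\<close> set without a hit node, and
      \<open>good\<close>, read contrapositively, bounds it.\<close>
    have Im: "I = {..<m}"
    proof -
      have "i < m" if "i \<in> I" for i
      proof -
        have "{..i} \<subseteq> I" using down that by auto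
        then have "card {..i} \<le> m" unfolding m_def using finI by (intro card_mono) auto
        then show ?thesis by simp
      qed
      then have "I \<subseteq> {..<m}" by auto
      then show ?thesis by (intro card_subset_eq) (simp_all only: m_def card_lessThan finite_lessThan)
    qed
    have "m \<le> hop k x"
    proof -
      have "I \<subseteq> {..<hop k x}" by (auto simp: I_def)
      then show ?thesis unfolding m_def by (metis card_lessThan card_mono finite_lessThan)
    qed
    have eq: "L x k = high_anc h k x m"
    proof -
      have "i < m \<longleftrightarrow> i < hop k x \<and> (\<forall>j\<le>i. \<not> hit (anc k j x))" for i
        using Im by (auto simp: I_def)
      then show ?thesis by (auto simp: L_def high_anc_def)
    qed
    have "\<not> hit v" if "v \<in> L x k" for v using that by (auto simp: L_def)
    then have "\<not> l \<le> card (high_anc h k x m)"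
      using good[OF _ _ \<open>m \<le> hop k x\<close>] PV[OF that] eq by blast
    then show ?thesis using eq finite_high_anc by auto
  qed
  have fin: "finite (P \<union> P\<inverse>)" using finP by simp
  have "{{v, par v k} |v k. buy v k} \<subseteq> A1 \<union> A2 \<union> A3"
  proof
    fix e assume "e \<in> {{v, par v k} |v k. buy v k}"
    then obtain v k where e: "e = {v, par v k}" and b: "buy v k" by auto
    note bi = buy_in[OF b]
    consider "k \<in> S" | "k \<notin> S" "card (nbrs v) < h" | "k \<notin> S" "h \<le> card (nbrs v)" by linarith
    then show "e \<in> A1 \<union> A2 \<union> A3"
    proof cases
      case 1
      then show ?thesis using bi e by (auto simp: A1_def)
    next
      case 2
      have "(v, par v k) \<in> E" using bi par_props(1)[of k v] E_sym T_subset S_subset by auto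
      then show ?thesis using 2 bi e by (auto simp: A2_def nbrs_def)
    next
      case 3
      then obtain x i where x: "partner x k" "i < hop k x" "v = anc k i x" "\<forall>j\<le>i. \<not> hit (anc k j x)"
        using buy_path[OF b] by auto
      have "(x, k) \<in> P \<union> P\<inverse>" using x(1) by (auto simp: partner_def)
      moreover have "v \<in> L x k" unfolding L_def using x 3 by blast
      ultimately show ?thesis using e by (auto simp: A3_def)
    qed
  qed
  moreover have fin1: "finite A1" and c1: "card A1 \<le> card V * card S"
    using finite_V finite_subset[OF S_subset] card_image_le[of "V \<times> S" "\<lambda>(v, k). {v, par v k}"]
    by (auto simp: A1_def card_cartesian_product)
  moreover have fin2: "finite A2" using finite_V finite_nbrs' by (auto simp: A2_def)
  moreover have c2: "card A2 \<le> card V * h"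
  proof -
    have "card A2 \<le> (\<Sum>v\<in>{v \<in> V. card (nbrs v) < h}. card ((\<lambda>w. {v, w}) ` nbrs v))"
      unfolding A2_def using finite_V by (intro card_UN_le) auto
    also have "\<dots> \<le> (\<Sum>v\<in>{v \<in> V. card (nbrs v) < h}. h)"
      by (intro sum_mono) (auto intro: order_trans[OF card_image_le[OF finite_nbrs']])
    also have "\<dots> \<le> card V * h" using card_mono[OF finite_V, of "{v \<in> V. card (nbrs v) < h}"] by simp
    finally show ?thesis .
  qed
  moreover have fin3: "finite A3" unfolding A3_def
    using L fin by (intro finite_UN_I) (auto split: prod.splits)
  moreover have c3: "card A3 \<le> 2 * card P * (l - 1)"
  proof -
    have "card A3 \<le> (\<Sum>p\<in>P \<union> P\<inverse>. card (case p of (x, k) \<Rightarrow> (\<lambda>v. {v, par v k}) ` L x k))"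
      unfolding A3_def by (intro card_UN_le fin)
    also have "\<dots> \<le> (\<Sum>p\<in>P \<union> P\<inverse>. l - 1)"
    proof (intro sum_mono)
      fix p assume p: "p \<in> P \<union> P\<inverse>"
      obtain x k where xk: "p = (x, k)" by (cases p)
      then show "card (case p of (x, k) \<Rightarrow> (\<lambda>v. {v, par v k}) ` L x k) \<le> l - 1"
        using L[of x k] p by (auto intro: order_trans[OF card_image_le])
    qed
    also have "\<dots> \<le> 2 * card P * (l - 1)"
      using card_Un_le[of P "P\<inverse>"] card_inverse[of P] by (simp add: mult_le_mono1)
    finally show ?thesis .
  qed
  ultimately have "num_bought \<le> card (A1 \<union> A2 \<union> A3)"
    unfolding num_bought_def bought_edges by (intro card_mono) auto
  also have "\<dots> \<le> card A1 + card A2 + card A3"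
    using card_Un_le[of "A1 \<union> A2" A3] card_Un_le[of A1 A2] by linarith
  finally show ?thesis using c1 c2 c3 by linarith
qed

end

lemma (in flooding) received_Suc:
  "received (\<lambda>w. sent_by t w \<union> set_option (item t w)) v = received (sent_by (Suc t)) v"
  by (simp add: received_def sent_by.simps(2))

lemma (in flooding) known_keys: "v \<in> V \<Longrightarrow> snd ` known_by t v \<subseteq> keys"
proof -
  assume "v \<in> V"
  then have "k \<in> keys" if "(e, k) \<in> known_by t v" for e k using known_sound that by blast
  then show ?thesis by auto
qed

section \<open>Forwarding purchases towards the roots\<close>

context marking
begin

definition wants :: "(nat \<times> nat) set \<Rightarrow> nat \<Rightarrow> nat \<Rightarrow> bool" where
  "wants B v k \<longleftrightarrow> k \<in> S \<or> (partner v k \<or> (\<exists>z. (z, k) \<in> B)) \<and> \<not> hit v"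

text \<open>Purchases travel towards the roots in the time-reversed order of the search: the slots of the
  search bound its running time, strictly increase along tree paths, and are distinct at each node,
  so that every node forwards at most one purchase per round.\<close>

primrec marks :: "nat \<Rightarrow> nat \<Rightarrow> nat \<Rightarrow> (nat \<times> nat) set" where
  "marks M 0 v = {}"
| "marks M (Suc u) v = marks M u v \<union>
     {(w, k). (w, v) \<in> E \<and> k \<in> keys \<and> k \<noteq> w \<and> par w k = v \<and> M - slot w k = u \<and> wants (marks M u w) w k}"

text \<open>With \<open>a = 1\<close> the order of the keys at \<open>v\<close> is by distance
  first. Along it the distance does not decrease and the rank strictly increases, so their sum does
  too.\<close>

lemma slot_inj:
  assumes "k \<in> keys" "k' \<in> keys" "slot v k = slot v k'" shows "k = k'"
proof (rule ccontr)
  have less: "slot v i < slot v j" if "i \<in> keys" "before v i j" for i j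
    using before_rank[OF that] that(2) unfolding slot_def before_def lex_le_pair by auto
  assume "k \<noteq> k'"
  then show False using before_total[of k k' v] less[of k k'] less[of k' k] assms by auto
qed

lemma slot_par:
  assumes "k \<in> keys" "v \<in> V" "v \<noteq> k" shows "slot (par v k) k < slot v k"
  using par_props[of k v] assms keys_eq T_subset S_subset
  by (intro slot_pred) (auto simp: key_dist_eq)

lemma buy_iff:
  assumes "v \<in> V" "v \<noteq> k"
  shows "buy v k \<longleftrightarrow> k \<in> S \<or> (partner v k \<or> (\<exists>z. buy z k \<and> par z k = v)) \<and> \<not> hit v"
proof
  assume "buy v k"
  then show "k \<in> S \<or> (partner v k \<or> (\<exists>z. buy z k \<and> par z k = v)) \<and> \<not> hit v"
    by cases auto
qed (use assms buy.intros in blast)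

text \<open>Node \<open>w\<close> decides about \<open>k\<close> in round
  \<open>M - slot w k\<close>. A child has a larger slot and hence decided earlier, so all purchases
  that could make \<open>w\<close> buy have reached it by then.\<close>

lemma marks_eq:
  assumes M: "\<And>v k. v \<in> V \<Longrightarrow> k \<in> keys \<Longrightarrow> slot v k \<le> M"
  shows "v \<in> V \<Longrightarrow> marks M u v = {(w, k). buy w k \<and> par w k = v \<and> M - slot w k < u}"
proof (induction u arbitrary: v)
  case 0
  then show ?case by auto
next
  case (Suc u)
  have "((w, v) \<in> E \<and> k \<in> keys \<and> k \<noteq> w \<and> par w k = v \<and> M - slot w k = u \<and> wants (marks M u w) w k)
      \<longleftrightarrow> (buy w k \<and> par w k = v \<and> M - slot w k = u)" for w k
  proof (cases "w \<in> V \<and> k \<in> keys \<and> k \<noteq> w \<and> par w k = v \<and> M - slot w k = u")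
    case True
    then have kV: "k \<in> V" using keys_eq T_subset S_subset by auto
    \<comment> \<open>The bound by \<open>M\<close> matters here: it keeps the truncated subtraction
      strictly decreasing in the slot.\<close>
    have early: "M - slot z k < u" if z: "buy z k" "par z k = w" for z
    proof -
      have zV: "z \<in> V" "z \<noteq> k" using buy_in[OF z(1)] by auto
      have "slot w k < slot z k" using slot_par[of k z] True zV z(2) by auto
      moreover have "slot z k \<le> M" using M zV True by blast
      ultimately show ?thesis using True by linarith
    qed
    have "(\<exists>z. (z, k) \<in> marks M u w) \<longleftrightarrow> (\<exists>z. buy z k \<and> par z k = w)"
      using Suc.IH[of w] True early by auto
    then have "wants (marks M u w) w k \<longleftrightarrow> buy w k"
      using buy_iff[of w k] True by (auto simp: wants_def)
    moreover have "(w, v) \<in> E" using par_props(1)[of k w] E_sym kV True by auto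
    ultimately show ?thesis using True by blast
  next
    case False
    then show ?thesis using buy_in[of w k] keys_eq E_subset by auto
  qed
  then have "{(w, k). (w, v) \<in> E \<and> k \<in> keys \<and> k \<noteq> w \<and> par w k = v \<and> M - slot w k = u \<and> wants (marks M u w) w k}
    = {(w, k). buy w k \<and> par w k = v \<and> M - slot w k = u}" by blast
  then show ?case using Suc by (auto simp: less_Suc_eq)
qed

end

section \<open>The algorithm\<close>

type_synonym sightings = "(nat \<times> nat \<times> nat) set"

datatype phase =
  Gather (clock: nat) (level: nat) (max_seen: nat) (change: nat) (heard: sightings) (told: "(nat \<times> nat) set")
| Select (quiet: nat) (terminals: "nat set") (quota: nat) (id_bound: nat) (key: nat) (clock: nat)
    (heard: sightings) (told: "(nat \<times> nat) set")
| Search (quiet: nat) (terminals: "nat set") (sampled: "nat set") (clock: nat)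
    (heard: sightings) (told: "(nat \<times> nat) set")
| Mark (sampled: "nat set") (plan: sightings) (near: bool) (deadline: nat) (clock: nat) (marked: "(nat \<times> nat) set")
| Finished (chosen: "nat set")

definition item_code :: "(nat \<times> nat) option \<Rightarrow> nat" where
  "item_code i = (case i of None \<Rightarrow> 0 | Some p \<Rightarrow> Suc (prod_encode p))"

definition item_of :: "nat \<Rightarrow> (nat \<times> nat) option" where
  "item_of x = (case x of 0 \<Rightarrow> None | Suc y \<Rightarrow> Some (prod_decode y))"

lemma item_of_code [simp]: "item_of (item_code i) = i"
  by (auto simp: item_of_def item_code_def split: option.splits)

text \<open>The key of a node occurring in a pair also carries the number of pairs it is the first component
  of; summing over the keys gives every node the total number of pairs.\<close>

definition pairs_key :: "knowledge \<Rightarrow> nat set" where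
  "pairs_key kn = (if own_pairs kn = {} then {}
     else {prod_encode (own_id kn, card {b. (own_id kn, b) \<in> own_pairs kn})})"

definition partners :: "knowledge \<Rightarrow> nat set" where
  "partners kn = {k. (k, own_id kn) \<in> own_pairs kn \<or> (own_id kn, k) \<in> own_pairs kn}"

text \<open>Smaller keys stand for higher levels, and \<open>N\<close> exceeds all identifiers.\<close>

definition level_key :: "nat \<Rightarrow> nat \<Rightarrow> nat \<Rightarrow> nat" where
  "level_key N l v = (4 * N - min l (4 * N)) * N + v"

definition smallest :: "nat \<Rightarrow> nat set \<Rightarrow> nat set" where
  "smallest q X = {k \<in> X. card {k' \<in> X. k' < k} < q}"

definition sample_size :: "real \<Rightarrow> nat \<Rightarrow> nat \<Rightarrow> nat" where
  "sample_size a p N = nat \<lceil>a * real p powr (1/3) * log 2 (real N) powr (2/3)\<rceil>"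

text \<open>Quota \<open>0\<close> doubles as the flag that the terminals themselves become the
  centers. The sum of the second components of the keys is the total number of pairs, and
  \<open>Suc m\<close> plays the part of \<open>N\<close>.\<close>

definition start_select :: "real \<Rightarrow> knowledge \<Rightarrow> nat \<Rightarrow> nat \<Rightarrow> nat \<Rightarrow> nat set \<Rightarrow> phase" where
  "start_select a kn s l m U =
     (let Q = sample_size a (\<Sum>k\<in>U. snd (prod_decode k)) (Suc m)
      in Select s ((fst \<circ> prod_decode) ` U) (if card U \<le> Q then 0 else Q) (Suc m)
           (level_key (Suc m) l (own_id kn)) 0 {} {})"

definition start_search :: "nat \<Rightarrow> nat set \<Rightarrow> nat \<Rightarrow> nat \<Rightarrow> nat set \<Rightarrow> phase" where
  "start_search s T q N X = Search s T (if q = 0 then T else (\<lambda>k. k mod N) ` smallest q X) 0 {} {}"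

definition best :: "knowledge \<Rightarrow> nat set \<Rightarrow> sightings \<Rightarrow> nat \<Rightarrow> nat" where
  "best kn U R k = (LEAST e. (e, k) \<in> known 1 ({own_id kn} \<inter> U) R)"

definition best_par :: "knowledge \<Rightarrow> nat set \<Rightarrow> sightings \<Rightarrow> nat \<Rightarrow> nat" where
  "best_par kn U R k =
     (LEAST w. w \<in> nbr_ids kn \<and> Suc (LEAST e. (w, e, k) \<in> R) = best kn U R k)"

text \<open>Each node recomputes its slots \<open>d k + r k\<close> from the distances that it has
  learned; \<open>M\<close> is the same everywhere because \<open>s\<close> and \<open>U\<close> are
  common knowledge by then. A plan entry consists of the round, the root and the parent to be
  told.\<close>

definition start_mark :: "knowledge \<Rightarrow> nat \<Rightarrow> nat set \<Rightarrow> nat set \<Rightarrow> sightings \<Rightarrow> phase" where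
  "start_mark kn s T S R =
     (let U = T \<union> S; M = 2 * s + card U; d = best kn U R;
          r = (\<lambda>k. card {k' \<in> U. lex_le (d k', k') (d k, k) \<and> k' \<noteq> k})
      in Mark S {(M - (d k + r k), k, best_par kn U R k) |k. k \<in> U \<and> k \<noteq> own_id kn}
           (\<exists>s\<in>S. d s \<le> 1) M 0 {})"

definition wanted :: "knowledge \<Rightarrow> nat set \<Rightarrow> bool \<Rightarrow> (nat \<times> nat) set \<Rightarrow> nat \<Rightarrow> bool" where
  "wanted kn S nr B k \<longleftrightarrow> k \<in> S \<or> (k \<in> partners kn \<or> (\<exists>z. (z, k) \<in> B)) \<and> \<not> nr"

definition tell :: "nat \<Rightarrow> nat set \<Rightarrow> sightings \<Rightarrow> (nat \<times> nat) set \<Rightarrow> (nat \<times> nat) option" where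
  "tell a own R S = next_item (known a own R) S"

definition hear :: "(nat \<Rightarrow> nat) \<Rightarrow> (nat \<Rightarrow> nat option) \<Rightarrow> sightings" where
  "hear f inbox = {(w, i). \<exists>x. inbox w = Some x \<and> item_of (f x) = Some i}"

fun msg :: "knowledge \<Rightarrow> phase \<Rightarrow> nat \<Rightarrow> nat option" where
  "msg kn (Gather t l m c R S) w =
     Some (prod_encode (m, prod_encode (c, item_code (tell 0 (pairs_key kn) R S))))"
| "msg kn (Select s T q N x t R S) w = Some (item_code (tell 0 {x} R S))"
| "msg kn (Search s T C t R S) w = Some (item_code (tell 1 ({own_id kn} \<inter> (T \<union> C)) R S))"
| "msg kn (Mark C pl nr M t B) w =
     (if \<exists>k. (t, k, w) \<in> pl \<and> wanted kn C nr B k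
      then Some (THE k. (t, k, w) \<in> pl \<and> wanted kn C nr B k) else None)"
| "msg kn (Finished X) w = None"

fun step :: "real \<Rightarrow> knowledge \<Rightarrow> phase \<Rightarrow> nat \<Rightarrow> (nat \<Rightarrow> nat option) \<Rightarrow> phase" where
  "step a kn (Gather t l m c R S) dr inbox =
     (let l' = (if t = 0 then dr else l);
          m' = Max (insert m {fst (prod_decode x) |w x. inbox w = Some x});
          S' = S \<union> set_option (tell 0 (pairs_key kn) R S);
          c' = (if m' \<noteq> m \<or> S' \<noteq> S then Suc t
                else Max (insert c {fst (prod_decode (snd (prod_decode x))) |w x. inbox w = Some x}));
          R' = R \<union> hear (\<lambda>x. snd (prod_decode (snd (prod_decode x)))) inbox
      in if 3 * c' + 2 \<le> Suc t then start_select a kn c' l' m' (snd ` known 0 (pairs_key kn) R')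
         else Gather (Suc t) l' m' c' R' S')"
| "step a kn (Select s T q N x t R S) dr inbox =
     (let S' = S \<union> set_option (tell 0 {x} R S); R' = R \<union> hear (\<lambda>x. x) inbox
      in if t = 2 * s + q then start_search s T q N (snd ` known 0 {x} R')
         else Select s T q N x (Suc t) R' S')"
| "step a kn (Search s T C t R S) dr inbox =
     (let S' = S \<union> set_option (tell 1 ({own_id kn} \<inter> (T \<union> C)) R S); R' = R \<union> hear (\<lambda>x. x) inbox
      in if t = 2 * s + card (T \<union> C) then start_mark kn s T C R'
         else Search s T C (Suc t) R' S')"
| "step a kn (Mark C pl nr M t B) dr inbox =
     (let B' = B \<union> {(w, k). inbox w = Some k}
      in if t = M then Finished ({w. \<exists>k. (w, k) \<in> B'} \<union> {w. \<exists>u k. (u, k, w) \<in> pl \<and> wanted kn C nr B' k})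
         else Mark C pl nr M (Suc t) B')"
| "step a kn (Finished X) dr inbox = Finished X"

definition start :: "knowledge \<Rightarrow> phase" where
  "start kn = Gather 0 0 (own_id kn) 0 {} {}"

declare (in marking) marks.simps(2) [simp del]
declare (in network) max_id.simps(2) [simp del]
declare (in flooding) sent_by.simps(2) [simp del] last_change.simps(2) [simp del]

section \<open>Lockstep: the state of every node in every round in closed form\<close>

locale execution = network V E for V E +
  fixes P :: "(nat \<times> nat) set" and dr :: "nat \<Rightarrow> nat" and a :: real
  assumes P_subset: "P \<subseteq> V \<times> V"
begin

definition kn :: "nat \<Rightarrow> knowledge" where
  "kn v = \<lparr> own_id = v, nbr_ids = {w. (v, w) \<in> E}, own_pairs = {(x, y) \<in> P. x = v \<or> y = v} \<rparr>"

primrec state :: "nat \<Rightarrow> nat \<Rightarrow> phase" where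
  "state 0 v = start (kn v)"
| "state (Suc t) v = step a (kn v) (state t v) (if t = 0 then dr v else 0)
     (\<lambda>w. if (w, v) \<in> E then msg (kn w) (state t w) v else None)"

declare state.simps(2) [simp del]

lemma kn_simps [simp]: "own_id (kn v) = v" "nbr_ids (kn v) = {w. (v, w) \<in> E}"
  "own_pairs (kn v) = {(x, y) \<in> P. x = v \<or> y = v}"
  by (auto simp: kn_def)

lemma finite_P: "finite P"
  using finite_subset[OF P_subset] finite_V by auto

definition T :: "nat set" where "T = {u. \<exists>v. (u, v) \<in> P \<or> (v, u) \<in> P}"

lemma T_subset: "T \<subseteq> V"
  using P_subset by (auto simp: T_def)

lemma pairs_key_kn:
  "pairs_key (kn v) = (if v \<in> T then {prod_encode (v, card {b. (v, b) \<in> P})} else {})"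
  by (auto simp: pairs_key_def T_def)

sublocale g: gathering V E "\<lambda>v. pairs_key (kn v)" "\<lambda>k. fst (prod_decode k)"
  by unfold_locales (auto simp: pairs_key_kn split: if_splits)

lemma gather_keys: "g.keys = (\<lambda>v. prod_encode (v, card {b. (v, b) \<in> P})) ` T"
  unfolding g.keys_def using T_subset by (auto simp: pairs_key_kn split: if_splits)

lemma gather_terminals: "(fst \<circ> prod_decode) ` g.keys = T"
  by (auto simp: gather_keys image_image)

lemma inj_keys: "inj_on (\<lambda>v. prod_encode (v, card {b. (v, b) \<in> P})) T"
  by (auto simp: inj_on_def)

lemma card_gather_keys: "card g.keys = card T"
  unfolding gather_keys by (rule card_image[OF inj_keys])

lemma gather_sum: "(\<Sum>k\<in>g.keys. snd (prod_decode k)) = card P"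
proof -
  have fT: "finite T" using T_subset finite_V finite_subset by auto
  have fb: "finite {b. (v, b) \<in> P}" for v
    using finite_P by (rule finite_subset[rotated, OF finite_imageI[of P snd]]) force
  have "(\<Sum>k\<in>g.keys. snd (prod_decode k)) = (\<Sum>v\<in>T. card {b. (v, b) \<in> P})"
    unfolding gather_keys by (subst sum.reindex[OF inj_keys]) simp
  also have "\<dots> = card (SIGMA v:T. {b. (v, b) \<in> P})"
    using fT fb by (subst card_SigmaI) auto
  also have "(SIGMA v:T. {b. (v, b) \<in> P}) = P" by (auto simp: T_def)
  finally show ?thesis .
qed

lemma hear_received:
  assumes "\<And>w. (w, v) \<in> E \<Longrightarrow> \<exists>x. inbox w = Some x \<and> f x = item_code (it w)"
    and "\<And>w. (w, v) \<notin> E \<Longrightarrow> inbox w = None"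
  shows "received So v \<union> hear f inbox = received (\<lambda>w. So w \<union> set_option (it w)) v"
proof -
  have "hear f inbox = {(w, i). (w, v) \<in> E \<and> it w = Some i}"
  proof -
    have "(\<exists>x. inbox w = Some x \<and> item_of (f x) = Some i) \<longleftrightarrow> (w, v) \<in> E \<and> it w = Some i" for w i
      using assms(1)[of w] assms(2)[of w] by (cases "(w, v) \<in> E") auto
    then show ?thesis by (auto simp: hear_def)
  qed
  then show ?thesis by (auto simp: received_def)
qed

definition T1 :: nat where "T1 = 3 * g.quiet_time + 2"

lemma gather_step:
  assumes v: "v \<in> V"
    and st: "\<And>w. w \<in> V \<Longrightarrow> state t w =
      Gather t (if t = 0 then 0 else dr w) (max_id t w) (g.last_change t w) (received (g.sent_by t) w) (g.sent_by t w)"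
  shows "state (Suc t) v =
    (if T1 \<le> Suc t
     then start_select a (kn v) (g.last_change (Suc t) v) (dr v) (max_id (Suc t) v) (snd ` g.known_by (Suc t) v)
     else Gather (Suc t) (dr v) (max_id (Suc t) v) (g.last_change (Suc t) v) (received (g.sent_by (Suc t)) v)
       (g.sent_by (Suc t) v))"
proof -
  define inbox where "inbox w = (if (w, v) \<in> E then msg (kn w) (state t w) v else None)" for w
  have inb: "inbox w = (if (w, v) \<in> E then Some (prod_encode (max_id t w,
      prod_encode (g.last_change t w, item_code (g.item t w)))) else None)" for w
    using st[of w] E_subset by (auto simp: inbox_def tell_def)
  have m: "{fst (prod_decode x) |w x. inbox w = Some x} = max_id t ` {w. (w, v) \<in> E}"
    unfolding inb by (auto split: if_splits)
  have c: "{fst (prod_decode (snd (prod_decode x))) |w x. inbox w = Some x} = g.last_change t ` {w. (w, v) \<in> E}"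
    unfolding inb by (auto split: if_splits)
  have r: "received (g.sent_by t) v \<union> hear (\<lambda>x. snd (prod_decode (snd (prod_decode x)))) inbox =
      received (g.sent_by (Suc t)) v"
    using hear_received[of v inbox "\<lambda>x. snd (prod_decode (snd (prod_decode x)))" "\<lambda>w. g.item t w" "g.sent_by t"]
    unfolding inb g.received_Suc by simp
  have s: "g.sent_by t v \<union> set_option (tell 0 (pairs_key (kn v)) (received (g.sent_by t) v) (g.sent_by t v)) =
      g.sent_by (Suc t) v"
    by (simp add: tell_def g.sent_by.simps(2))
  have mm: "Max (insert (max_id t v) {fst (prod_decode x) |w x. inbox w = Some x}) = max_id (Suc t) v"
    unfolding m by (simp add: max_id.simps(2))
  have cc: "(if max_id (Suc t) v \<noteq> max_id t v \<or> g.sent_by (Suc t) v \<noteq> g.sent_by t v then Suc t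
      else Max (insert (g.last_change t v) {fst (prod_decode (snd (prod_decode x))) |w x. inbox w = Some x}))
      = g.last_change (Suc t) v"
    unfolding c g.last_change.simps(2) g.changed_def by simp
  show ?thesis
    unfolding state.simps(2) inbox_def[symmetric] st[OF v] step.simps r s mm cc Let_def
    using g.detect_iff[OF v, of "Suc t"] by (auto simp: T1_def)
qed

lemma state_gather:
  "t < T1 \<Longrightarrow> v \<in> V \<Longrightarrow> state t v =
    Gather t (if t = 0 then 0 else dr v) (max_id t v) (g.last_change t v) (received (g.sent_by t) v) (g.sent_by t v)"
proof (induction t arbitrary: v)
  case 0
  then show ?case by (simp add: start_def received_def)
next
  case (Suc t)
  then show ?case by (subst gather_step) auto
qed

definition N :: nat where "N = Suc (Max V)"

definition Q :: nat where "Q = sample_size a (card P) N"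

definition q :: nat where "q = (if card T \<le> Q then 0 else Q)"

lemma less_N: "v \<in> V \<Longrightarrow> v < N"
  using finite_V by (auto simp: N_def less_Suc_eq_le)

lemma state_T1:
  assumes "v \<in> V" shows "state T1 v = Select g.quiet_time T q N (level_key N (dr v) v) 0 {} {}"
proof -
  define t where "t = 3 * g.quiet_time + 1"
  have t: "T1 = Suc t" by (simp add: T1_def t_def)
  have "t < T1" "T1 \<le> Suc t" using t by auto
  then have "state (Suc t) v = start_select a (kn v) (g.last_change (Suc t) v) (dr v) (max_id (Suc t) v)
      (snd ` g.known_by (Suc t) v)"
    using gather_step[OF assms state_gather] by simp
  then have "state T1 v = start_select a (kn v) (g.last_change T1 v) (dr v) (max_id T1 v) (snd ` g.known_by T1 v)"
    by (simp only: t)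
  moreover have "g.last_change T1 v = g.quiet_time" using g.last_change_final[OF assms, of T1] by (simp add: T1_def)
  moreover have "max_id T1 v = Max V" using g.max_id_quiet[OF assms, of T1] by (simp add: T1_def)
  moreover have "snd ` g.known_by T1 v = g.keys"
  proof -
    have "g.sent_by T1 v \<subseteq> g.known_by T1 v" by (rule g.sent_known)
    moreover have "g.sent_by T1 v = {0} \<times> g.keys" using g.sent_quiet[OF assms, of T1] by (simp add: T1_def)
    moreover have "snd ` g.known_by T1 v \<subseteq> g.keys" by (rule g.known_keys[OF assms])
    moreover have "snd ` ({0::nat} \<times> g.keys) = g.keys" by simp
    ultimately show ?thesis by (metis image_mono subset_antisym)
  qed
  ultimately show ?thesis
    by (simp add: start_select_def gather_sum gather_terminals[unfolded comp_def] card_gather_keys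
        Let_def N_def Q_def q_def)
qed

lemma level_key_mod: "v \<in> V \<Longrightarrow> level_key N l v mod N = v"
  using less_N by (simp add: level_key_def)

sublocale sel: flooding V E 0 "\<lambda>v. {level_key N (dr v) v}" "\<lambda>k. k mod N"
  by unfold_locales (auto simp: level_key_mod)

definition T2 :: nat where "T2 = T1 + 2 * g.quiet_time + q + 1"

definition centers :: "nat set" where
  "centers = (if q = 0 then T else (\<lambda>k. k mod N) ` smallest q sel.keys)"

lemma sel_keys: "sel.keys = (\<lambda>v. level_key N (dr v) v) ` V"
  by (auto simp: sel.keys_def)

lemma centers_subset: "centers \<subseteq> V"
  using T_subset by (auto simp: centers_def smallest_def sel_keys level_key_mod)

lemma select_step:
  assumes v: "v \<in> V"
    and st: "\<And>w. w \<in> V \<Longrightarrow> state t' w =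
      Select g.quiet_time T q N (level_key N (dr w) w) t (received (sel.sent_by t) w) (sel.sent_by t w)"
  shows "state (Suc t') v =
    (if t = 2 * g.quiet_time + q then start_search g.quiet_time T q N (snd ` sel.known_by (Suc t) v)
     else Select g.quiet_time T q N (level_key N (dr v) v) (Suc t) (received (sel.sent_by (Suc t)) v) (sel.sent_by (Suc t) v))"
proof -
  define inbox where "inbox w = (if (w, v) \<in> E then msg (kn w) (state t' w) v else None)" for w
  have inb: "inbox w = (if (w, v) \<in> E then Some (item_code (sel.item t w)) else None)" for w
    using st[of w] E_subset by (auto simp: inbox_def tell_def)
  have r: "received (sel.sent_by t) v \<union> hear (\<lambda>x. x) inbox = received (sel.sent_by (Suc t)) v"
    using hear_received[of v inbox "\<lambda>x. x" "\<lambda>w. sel.item t w" "sel.sent_by t"]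
    unfolding inb sel.received_Suc by simp
  show ?thesis
    unfolding state.simps(2) inbox_def[symmetric] st[OF v] step.simps r Let_def
    by (simp add: tell_def sel.sent_by.simps(2))
qed

lemma state_select:
  "t \<le> 2 * g.quiet_time + q \<Longrightarrow> v \<in> V \<Longrightarrow> state (T1 + t) v =
    Select g.quiet_time T q N (level_key N (dr v) v) t (received (sel.sent_by t) v) (sel.sent_by t v)"
proof (induction t arbitrary: v)
  case 0
  then show ?case by (simp add: state_T1 received_def)
next
  case (Suc t)
  then show ?case using select_step[of v "T1 + t" t] by simp
qed

lemma sel_before: "sel.before v k' k \<longleftrightarrow> k' < k"
  by (auto simp: sel.before_def lex_le_pair)

text \<open>Allows the selection of centers to stop once the \<open>q\<close> smallest keys have
  arrived everywhere, which takes \<open>2 * quiet_time + q\<close> rounds; waiting for the keys of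
  all nodes would exceed the round budget.\<close>

lemma smallest_eq:
  assumes "X \<subseteq> Y" "finite Y" "smallest q Y \<subseteq> X" shows "smallest q X = smallest q Y"
proof
  show "smallest q Y \<subseteq> smallest q X"
  proof
    fix k assume k: "k \<in> smallest q Y"
    have "card {k' \<in> X. k' < k} \<le> card {k' \<in> Y. k' < k}" using assms by (intro card_mono) auto
    then show "k \<in> smallest q X" using k assms by (auto simp: smallest_def)
  qed
  show "smallest q X \<subseteq> smallest q Y"
  proof
    fix k assume k: "k \<in> smallest q X"
    show "k \<in> smallest q Y"
    proof (rule ccontr)
      assume n: "k \<notin> smallest q Y"
      have kY: "k \<in> Y" using k assms by (auto simp: smallest_def)
      define Z where "Z = {k' \<in> Y. k' < k}"
      have fZ: "finite Z" using assms by (auto simp: Z_def)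
      have q: "q \<le> card Z" using n kY by (auto simp: smallest_def Z_def)
      have "Z \<subseteq> X"
      proof (rule ccontr)
        assume "\<not> Z \<subseteq> X"
        then have ne: "Z - X \<noteq> {}" by auto
        \<comment> \<open>The least element below \<open>k\<close> that is missing from
          \<open>X\<close>. Everything below it is present, so its rank in \<open>Y\<close> is at
          most the rank of \<open>k\<close> in \<open>X\<close>, hence less than \<open>q\<close>;
          but the \<open>q\<close> smallest elements of \<open>Y\<close> are not missing.\<close>
        define j where "j = Min (Z - X)"
        have j: "j \<in> Z - X" unfolding j_def using ne fZ by (intro Min_in) auto
        have below: "{k' \<in> Y. k' < j} \<subseteq> {k' \<in> X. k' < k}"
        proof
          fix i assume i: "i \<in> {k' \<in> Y. k' < j}"
          then have iZ: "i \<in> Z" using j by (auto simp: Z_def)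
          have "i \<in> X"
          proof (rule ccontr)
            assume "i \<notin> X"
            then have "j \<le> i" unfolding j_def using iZ fZ by (intro Min_le) auto
            then show False using i by auto
          qed
          then show "i \<in> {k' \<in> X. k' < k}" using iZ by (auto simp: Z_def)
        qed
        have "card {k' \<in> Y. k' < j} \<le> card {k' \<in> X. k' < k}"
          using finite_subset[OF assms(1,2)] by (intro card_mono below) auto
        then have "j \<in> smallest q Y" using j k by (auto simp: smallest_def Z_def)
        then show False using assms(3) j by auto
      qed
      then have "Z = {k' \<in> X. k' < k}" using assms(1) by (auto simp: Z_def)
      then show False using q k by (auto simp: smallest_def)
    qed
  qed
qed

lemma state_T2: 
  assumes v: "v \<in> V" shows "state T2 v = Search g.quiet_time T centers 0 {} {}"
proof -
  define t where "t = 2 * g.quiet_time + q"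
  have T2_eq: "T2 = Suc (T1 + t)" by (simp add: T2_def t_def)
  have "state (Suc (T1 + t)) v = start_search g.quiet_time T q N (snd ` sel.known_by (Suc t) v)"
  proof -
    have "t \<le> 2 * g.quiet_time + q" by (simp add: t_def)
    then show ?thesis using select_step[OF v, OF state_select, of t] by (simp only: t_def if_True refl)
  qed
  moreover have "smallest q (snd ` sel.known_by (Suc t) v) = smallest q sel.keys"
  proof (rule smallest_eq)
    show "snd ` sel.known_by (Suc t) v \<subseteq> sel.keys" by (rule sel.known_keys[OF v])
    show "finite sel.keys" by (rule sel.finite_keys)
    show "smallest q sel.keys \<subseteq> snd ` sel.known_by (Suc t) v"
    proof
      fix k assume k: "k \<in> smallest q sel.keys"
      then have kk: "k \<in> sel.keys" and r: "sel.rank v k < q"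
        by (auto simp: smallest_def sel.rank_def sel_before)
      have "k mod N \<in> V" using sel.owner_in[OF kk] by auto
      then have "sel.slot v k \<le> Suc t"
        using r g.hop_le_quiet[of "k mod N" v] v by (simp add: sel.slot_def sel.key_dist_def t_def)
      then have "(0 * sel.key_dist v k, k) \<in> sel.known_by (Suc t) v" by (rule sel.known_slot[OF v kk])
      then show "k \<in> snd ` sel.known_by (Suc t) v" by force
    qed
  qed
  ultimately show ?thesis by (simp add: start_search_def centers_def T2_eq)
qed

end

context execution
begin

declare One_nat_def [simp del]

sublocale mk: marking V E T centers P
  by unfold_locales (use T_subset centers_subset in \<open>auto simp: T_def\<close>)

definition M :: nat where "M = 2 * g.quiet_time + card (T \<union> centers)"

lemma mk_slot_less: 
  assumes "v \<in> V" "k \<in> mk.keys" shows "mk.slot v k < M"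
proof -
  have "k \<in> V" using assms(2) mk.keys_eq T_subset centers_subset by auto
  then have "hop k v \<le> 2 * g.quiet_time" using g.hop_le_quiet assms(1) by blast
  moreover have "mk.rank v k < card (T \<union> centers)" using mk.rank_less[OF assms(2), of v] mk.keys_eq by metis
  ultimately show ?thesis unfolding mk.slot_def mk.key_dist_eq M_def by linarith
qed

lemma search_step:
  assumes v: "v \<in> V"
    and st: "\<And>w. w \<in> V \<Longrightarrow> state t' w =
      Search g.quiet_time T centers t (received (mk.sent_by t) w) (mk.sent_by t w)"
  shows "state (Suc t') v =
    (if t = M then start_mark (kn v) g.quiet_time T centers (received (mk.sent_by (Suc t)) v)
     else Search g.quiet_time T centers (Suc t) (received (mk.sent_by (Suc t)) v) (mk.sent_by (Suc t) v))"
proof -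
  define inbox where "inbox w = (if (w, v) \<in> E then msg (kn w) (state t' w) v else None)" for w
  have inb: "inbox w = (if (w, v) \<in> E then Some (item_code (mk.item t w)) else None)" for w
    using st[of w] E_subset by (auto simp: inbox_def tell_def)
  have r: "received (mk.sent_by t) v \<union> hear (\<lambda>x. x) inbox = received (mk.sent_by (Suc t)) v"
    using hear_received[of v inbox "\<lambda>x. x" "\<lambda>w. mk.item t w" "mk.sent_by t"]
    unfolding inb mk.received_Suc by simp
  show ?thesis
    unfolding state.simps(2) inbox_def[symmetric] st[OF v] step.simps r Let_def M_def
    by (simp add: tell_def mk.sent_by.simps(2))
qed

lemma state_search:
  "t \<le> M \<Longrightarrow> v \<in> V \<Longrightarrow> state (T2 + t) v =
    Search g.quiet_time T centers t (received (mk.sent_by t) v) (mk.sent_by t v)"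
proof (induction t arbitrary: v)
  case 0
  then show ?case by (simp add: state_T2 received_def)
next
  case (Suc t)
  then show ?case using search_step[of v "T2 + t" t] by simp
qed

definition T3 :: nat where "T3 = T2 + M + 1"

definition plan_of :: "nat \<Rightarrow> sightings" where
  "plan_of v = {(M - mk.slot v k, k, par v k) |k. k \<in> mk.keys \<and> k \<noteq> v}"

lemma best_eq:
  assumes "v \<in> V" "k \<in> mk.keys"
  shows "best (kn v) (T \<union> centers) (received (mk.sent_by (Suc M)) v) k = hop k v"
proof -
  have "(1 * hop k v, k) \<in> mk.known_by (Suc M) v"
    using mk.known_slot[OF assms, of "Suc M"] mk_slot_less[OF assms] unfolding mk.key_dist_eq by simp
  moreover have "hop k v \<le> e" if "(e, k) \<in> mk.known_by (Suc M) v" for e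
    using mk.known_sound[OF assms(1) that] unfolding mk.key_dist_eq by simp
  ultimately show ?thesis unfolding best_def by (intro Least_equality) auto
qed

lemma heard_eq:
  assumes "(w, v) \<in> E" "k \<in> mk.keys"
  shows "(LEAST e. (w, e, k) \<in> received (mk.sent_by (Suc M)) v) = hop k w"
proof -
  have w: "w \<in> V" using assms E_subset by auto
  have "(1 * hop k w, k) \<in> mk.sent_by (Suc M) w"
    using mk.sent_slot[OF w assms(2), of "Suc M"] mk_slot_less[OF w assms(2)] unfolding mk.key_dist_eq by simp
  moreover have "hop k w \<le> e" if "(e, k) \<in> mk.sent_by (Suc M) w" for e
    using mk.known_sound[OF w] mk.sent_known that unfolding mk.key_dist_eq by fastforce
  ultimately show ?thesis using assms(1) by (intro Least_equality) (auto simp: received_def)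
qed

lemma best_par_eq:
  assumes "v \<in> V" "k \<in> mk.keys"
  shows "best_par (kn v) (T \<union> centers) (received (mk.sent_by (Suc M)) v) k = par v k"
proof -
  have "(w \<in> nbr_ids (kn v) \<and> Suc (LEAST e. (w, e, k) \<in> received (mk.sent_by (Suc M)) v) = hop k v)
    \<longleftrightarrow> ((w, v) \<in> E \<and> Suc (hop k w) = hop k v)" for w
    using heard_eq[of w v k] assms(2) E_sym by auto
  then show ?thesis unfolding best_par_def best_eq[OF assms] par_def by simp
qed

lemma state_T3:
  assumes v: "v \<in> V"
  shows "state T3 v = Mark centers (plan_of v) (mk.hit v) M 0 {}"
proof -
  define R where "R = received (mk.sent_by (Suc M)) v"
  have T3_eq: "T3 = Suc (T2 + M)" by (simp add: T3_def)
  have b: "best (kn v) (T \<union> centers) R k = hop k v" if "k \<in> T \<union> centers" for k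
    using best_eq[OF v] that unfolding R_def mk.keys_eq by blast
  have p: "best_par (kn v) (T \<union> centers) R k = par v k" if "k \<in> T \<union> centers" for k
    using best_par_eq[OF v] that unfolding R_def mk.keys_eq by blast
  have r: "card {k' \<in> T \<union> centers. lex_le (best (kn v) (T \<union> centers) R k', k') (best (kn v) (T \<union> centers) R k, k) \<and> k' \<noteq> k}
      = mk.rank v k" if "k \<in> T \<union> centers" for k
  proof -
    have "{k' \<in> T \<union> centers. lex_le (best (kn v) (T \<union> centers) R k', k') (best (kn v) (T \<union> centers) R k, k) \<and> k' \<noteq> k}
      = {k' \<in> mk.keys. mk.before v k' k}"
      using b that unfolding mk.keys_eq mk.before_def mk.key_dist_eq by auto
    then show ?thesis unfolding mk.rank_def by simp
  qed
  have "state T3 v = start_mark (kn v) g.quiet_time T centers R"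
    unfolding T3_eq R_def using search_step[OF v state_search, of M] by simp
  also have "\<dots> = Mark centers (plan_of v) (mk.hit v) M 0 {}"
  proof -
    have "{(M - (best (kn v) (T \<union> centers) R k +
        card {k' \<in> T \<union> centers. lex_le (best (kn v) (T \<union> centers) R k', k') (best (kn v) (T \<union> centers) R k, k) \<and> k' \<noteq> k}),
        k, best_par (kn v) (T \<union> centers) R k) |k. k \<in> T \<union> centers \<and> k \<noteq> v} = plan_of v"
      unfolding plan_of_def mk.keys_eq setcompr_eq_image
    proof (rule image_cong[OF refl])
      fix k assume "k \<in> {k. k \<in> T \<union> centers \<and> k \<noteq> v}"
      then have k: "k \<in> T \<union> centers" by simp
      show "(M - (best (kn v) (T \<union> centers) R k +
        card {k' \<in> T \<union> centers. lex_le (best (kn v) (T \<union> centers) R k', k') (best (kn v) (T \<union> centers) R k, k) \<and> k' \<noteq> k}),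
        k, best_par (kn v) (T \<union> centers) R k) = (M - mk.slot v k, k, par v k)"
        unfolding r[OF k] p[OF k] mk.slot_def mk.key_dist_eq by (simp only: b[OF k])
    qed
    moreover have "(\<exists>s\<in>centers. best (kn v) (T \<union> centers) R s \<le> 1) = mk.hit v"
      unfolding mk.hit_def using b by (intro bex_cong) auto
    ultimately show ?thesis unfolding start_mark_def Let_def M_def by simp
  qed
  finally show ?thesis .
qed

lemma wanted_eq: "v \<in> V \<Longrightarrow> wanted (kn v) centers (mk.hit v) B k = mk.wants B v k"
  by (auto simp: wanted_def mk.wants_def mk.partner_def partners_def)

definition forwards :: "nat \<Rightarrow> nat \<Rightarrow> nat \<Rightarrow> nat \<Rightarrow> bool" where
  "forwards u w k v \<longleftrightarrow>
     k \<in> mk.keys \<and> k \<noteq> w \<and> par w k = v \<and> M - mk.slot w k = u \<and> mk.wants (mk.marks M u w) w k"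

text \<open>The slots at \<open>w\<close> are distinct and lie below \<open>M\<close>, so
  \<open>M - slot\<close> is injective on them. One identifier per round therefore suffices as a
  message.\<close>

lemma forwards_unique:
  "w \<in> V \<Longrightarrow> forwards u w k v \<Longrightarrow> forwards u w k' v' \<Longrightarrow> k = k'"
  unfolding forwards_def using mk.slot_inj[of k k' w] mk_slot_less[of w k] mk_slot_less[of w k'] by linarith

lemma msg_mark:
  assumes w: "w \<in> V"
  shows "msg (kn w) (Mark centers (plan_of w) (mk.hit w) M u (mk.marks M u w)) v = Some k \<longleftrightarrow> forwards u w k v"
proof -
  have eq: "(u, k, v) \<in> plan_of w \<and> wanted (kn w) centers (mk.hit w) (mk.marks M u w) k \<longleftrightarrow> forwards u w k v" for k
    unfolding wanted_eq[OF w] by (auto simp: plan_of_def forwards_def)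
  show ?thesis
  proof (cases "\<exists>k. forwards u w k v")
    case True
    then obtain j where j: "forwards u w j v" by auto
    then have "(THE k. forwards u w k v) = j" using forwards_unique[OF w] by blast
    then show ?thesis using j forwards_unique[OF w, of u j v k v] by (auto simp: eq)
  next
    case False
    then show ?thesis by (auto simp: eq)
  qed
qed

lemma mark_step:
  assumes v: "v \<in> V"
    and st: "\<And>w. w \<in> V \<Longrightarrow> state t' w = Mark centers (plan_of w) (mk.hit w) M u (mk.marks M u w)"
  shows "state (Suc t') v =
    (if u = M then Finished ({w. \<exists>k. (w, k) \<in> mk.marks M (Suc u) v} \<union>
       {w. \<exists>u' k. (u', k, w) \<in> plan_of v \<and> mk.wants (mk.marks M (Suc u) v) v k})
     else Mark centers (plan_of v) (mk.hit v) M (Suc u) (mk.marks M (Suc u) v))"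
proof -
  define inbox where "inbox w = (if (w, v) \<in> E then msg (kn w) (state t' w) v else None)" for w
  have "inbox w = Some k \<longleftrightarrow> (w, v) \<in> E \<and> forwards u w k v" for w k
    using st[of w] E_subset msg_mark[of w u v k] by (auto simp: inbox_def)
  then have B: "mk.marks M u v \<union> {(w, k). inbox w = Some k} = mk.marks M (Suc u) v"
    by (simp add: forwards_def mk.marks.simps(2))
  show ?thesis
    unfolding state.simps(2) inbox_def[symmetric] st[OF v] step.simps Let_def B wanted_eq[OF v] ..
qed

lemma state_mark:
  "u \<le> M \<Longrightarrow> v \<in> V \<Longrightarrow> state (T3 + u) v = Mark centers (plan_of v) (mk.hit v) M u (mk.marks M u v)"
proof (induction u arbitrary: v)
  case 0
  then show ?case by (simp add: state_T3)
next
  case (Suc u)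
  then show ?case using mark_step[of v "T3 + u" u] by simp
qed

definition T4 :: nat where "T4 = T3 + M + 1"

lemma state_T4:
  assumes v: "v \<in> V" shows "state T4 v = Finished {w. (v, w) \<in> mk.bought}"
proof -
  have T4_eq: "T4 = Suc (T3 + M)" by (simp add: T4_def)
  have marks: "mk.marks M (Suc M) v = {(w, k). mk.buy w k \<and> par w k = v}"
    using mk.marks_eq[OF less_imp_le[OF mk_slot_less] v, of "Suc M"] by (auto simp: less_Suc_eq_le)
  have "mk.wants {(w, k). mk.buy w k \<and> par w k = v} v k \<longleftrightarrow> mk.buy v k" if "k \<noteq> v" for k
    using mk.buy_iff[OF v, of k] that by (auto simp: mk.wants_def)
  then have "{w. \<exists>k. (w, k) \<in> mk.marks M (Suc M) v} \<union>
       {w. \<exists>u' k. (u', k, w) \<in> plan_of v \<and> mk.wants (mk.marks M (Suc M) v) v k} = {w. (v, w) \<in> mk.bought}"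
    unfolding marks using mk.buy_in[of v] mk.keys_eq by (fastforce simp: plan_of_def mk.bought_def)
  then show ?thesis unfolding T4_eq using mark_step[OF v state_mark, of M] by simp
qed

lemma state_after: "v \<in> V \<Longrightarrow> T4 \<le> t \<Longrightarrow> state t v = Finished {w. (v, w) \<in> mk.bought}"
proof -
  assume v: "v \<in> V" and "T4 \<le> t"
  from this(2) show ?thesis
    by (induction t rule: dec_induct) (simp_all add: state_T4[OF v] state.simps(2))
qed

end

section \<open>Number of rounds and size of messages\<close>

lemma card_smallest_le:
  assumes "finite X" shows "card (smallest q X) \<le> q"
proof (cases "smallest q X = {}")
  case False
  have fin: "finite (smallest q X)" using assms by (auto simp: smallest_def)
  define m where "m = Max (smallest q X)"
  have m: "m \<in> smallest q X" unfolding m_def using fin False by (rule Max_in)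
  have "k \<le> m" if "k \<in> smallest q X" for k unfolding m_def using fin that by simp
  then have "smallest q X - {m} \<subseteq> {k' \<in> X. k' < m}" by (force simp: smallest_def)
  then have "card (smallest q X - {m}) \<le> card {k' \<in> X. k' < m}" using assms by (intro card_mono) auto
  then have "card (smallest q X) - 1 \<le> card {k' \<in> X. k' < m}" using m fin by simp
  moreover have "card {k' \<in> X. k' < m} < q" using m by (simp add: smallest_def)
  ultimately show ?thesis by linarith
qed simp

text \<open>Cantor pairing is quadratic: it doubles the exponent, and the constant \<open>4\<close>
  is absorbed by \<open>Z^2\<close>. Nested encodings thus stay polynomial in
  \<open>Z\<close>.\<close>

lemma prod_encode_le:
  assumes "a \<le> Z ^ j" "b \<le> Z ^ j" "2 \<le> Z" shows "prod_encode (a, b) \<le> Z ^ (2 * j + 2)"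
proof -
  define y where "y = Z ^ j"
  have y1: "1 \<le> y" using assms(3) by (simp add: y_def)
  have "triangle m * 2 = m * (m + 1)" for m by (induction m) auto
  then have "2 * prod_encode (a, b) = (a + b) * (a + b + 1) + 2 * a"
    unfolding prod_encode_def by (metis (no_types, lifting) add_mult_distrib2 mult.commute prod.case)
  also have "\<dots> \<le> (2 * y) * (2 * y + 1) + 2 * y"
    using assms(1,2) by (intro add_mono mult_mono) (auto simp: y_def)
  also have "\<dots> \<le> 2 * (4 * (y * y))" using y1 by (cases y) auto
  finally have "prod_encode (a, b) \<le> 4 * (y * y)" by simp
  also have "\<dots> \<le> Z ^ 2 * (y * y)" using power_mono[OF assms(3), of 2] by (intro mult_right_mono) auto
  also have "\<dots> = Z ^ (2 * j + 2)" by (simp add: y_def power_add power_mult mult.commute power2_eq_square)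
  finally show ?thesis .
qed

lemma item_code_le:
  assumes "e \<le> Z ^ j" "k \<le> Z ^ j" "2 \<le> Z" shows "item_code (Some (e, k)) \<le> Z ^ (2 * j + 3)"
proof -
  have "1 \<le> Z ^ (2 * j + 2)" using assms(3) by simp
  then have "Suc (prod_encode (e, k)) \<le> 2 * Z ^ (2 * j + 2)" using prod_encode_le[OF assms] by linarith
  also have "\<dots> \<le> Z * Z ^ (2 * j + 2)" using assms(3) by (rule mult_right_mono) simp
  finally show ?thesis by (simp add: item_code_def eval_nat_numeral)
qed

context execution
begin

lemma q_le: "q \<le> card T"
  by (simp add: q_def)

lemma card_centers: "card centers \<le> (if q = 0 then card T else q)"
proof -
  have fin: "finite (smallest q sel.keys)" using sel.finite_keys by (simp add: smallest_def)
  show ?thesis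
    using card_image_le[OF fin, of "\<lambda>k. k mod N"] card_smallest_le[OF sel.finite_keys, of q]
    by (simp add: centers_def)
qed

lemma M_le: "M \<le> 2 * g.quiet_time + 2 * card T"
  using card_Un_le[of T centers] card_centers q_le by (simp add: M_def split: if_splits)

lemma quiet_le: "g.quiet_time \<le> diam + card T"
  using g.quiet_time_le card_gather_keys by simp

text \<open>With \<open>s\<close> the quiet time, the schedule adds up to
  \<open>5 s + q + 2 M + 5\<close>. Then \<open>M\<close> is at most
  \<open>2 s + 2 * card T\<close>, \<open>q\<close> at most \<open>card T\<close>, and
  \<open>s\<close> at most \<open>diam + card T\<close>.\<close>

lemma T4_le: "T4 \<le> 9 * diam + 14 * card T + 5"
  using M_le quiet_le q_le unfolding T4_def T3_def T2_def T1_def by linarith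

lemma diam_less: "diam < card V"
proof -
  have "{hop u v |u v. u \<in> V \<and> v \<in> V} \<noteq> {}" using V_nonempty by auto
  then have "diam \<in> {hop u v |u v. u \<in> V \<and> v \<in> V}" unfolding diam_def by (intro Max_in finite_hops)
  then show ?thesis using hop_less_card by auto
qed

lemma card_V_le_N: "card V \<le> N"
  using less_N card_mono[of "{..<N}" V] by auto

lemma small_quantities:
  shows "card T \<le> N" "g.quiet_time \<le> 2 * N" "M \<le> 6 * N"
proof -
  show T: "card T \<le> N" using card_mono[OF finite_V T_subset] card_V_le_N by simp
  show s: "g.quiet_time \<le> 2 * N" using quiet_le T diam_less card_V_le_N by linarith
  show "M \<le> 6 * N" using M_le s T by linarith
qed

lemma item_code_tell_le:
  assumes "\<And>e k. (e, k) \<in> known b own R \<Longrightarrow> e \<le> Z ^ j \<and> k \<le> Z ^ j" "2 \<le> Z"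
  shows "item_code (tell b own R So) \<le> Z ^ (2 * j + 3)"
proof (cases "tell b own R So")
  case None
  then show ?thesis by (simp add: item_code_def)
next
  case (Some i)
  then have "i \<in> known b own R" using next_item_fresh by (auto simp: tell_def)
  then show ?thesis using Some assms item_code_le[of "fst i" Z j "snd i"] by (cases i) auto
qed

text \<open>The exponent comes from the first flood: a key costs \<open>4\<close>, its item code
  \<open>2 * 4 + 3 = 11\<close>, pairing with the last change \<open>24\<close>, and pairing with
  the maximal identifier \<open>50\<close>. The other phases need less; the cap on levels in
  \<open>level_key\<close> keeps the keys of the selection polynomial.\<close>

lemma msg_le:
  assumes n: "2 \<le> card V" and u: "u \<in> V" and x: "msg (kn u) (state t u) v = Some x"
  shows "x \<le> (2 * N) ^ 50"
proof -
  define Z where "Z = 2 * N"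
  have Z: "4 \<le> Z" using n card_V_le_N by (simp add: Z_def)
  have Zp: "Z ^ i \<le> Z ^ j" if "i \<le> j" for i j using Z that by (intro power_increasing) auto
  have Z3: "16 * Z \<le> Z ^ 3"
  proof -
    have "4 * 4 * Z \<le> Z * Z * Z" using Z by (intro mult_right_mono mult_mono) auto
    then show ?thesis by (simp add: power3_eq_cube)
  qed
  have V_le: "w \<le> Z" if "w \<in> V" for w using less_N[OF that] by (simp add: Z_def)
  consider "t < T1" | i where "t = T1 + i" "i \<le> 2 * g.quiet_time + q" | i where "t = T2 + i" "i \<le> M"
    | i where "t = T3 + i" "i \<le> M" | "T4 \<le> t"
  proof -
    have "t < T1 \<or> (T1 \<le> t \<and> t - T1 \<le> 2 * g.quiet_time + q) \<or> (T2 \<le> t \<and> t - T2 \<le> M) \<or>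
        (T3 \<le> t \<and> t - T3 \<le> M) \<or> T4 \<le> t"
      unfolding T4_def T3_def T2_def by linarith
    then show ?thesis using that by (metis le_add_diff_inverse)
  qed
  then show ?thesis
  proof cases
    case 1
    have keys: "e \<le> Z ^ 4 \<and> k \<le> Z ^ 4" if "(e, k) \<in> g.known_by t u" for e k
    proof -
      have ek: "k \<in> g.keys" "e = 0" using g.known_sound[OF u that] by auto
      then obtain w where w: "w \<in> V" "k = prod_encode (w, card {b. (w, b) \<in> P})"
        using T_subset by (auto simp: gather_keys)
      have "card {b. (w, b) \<in> P} \<le> card V" using P_subset by (intro card_mono finite_V) auto
      then have "card {b. (w, b) \<in> P} \<le> Z ^ 1" using card_V_le_N by (simp add: Z_def)
      then show ?thesis using prod_encode_le[of w Z 1] V_le[OF w(1)] Z ek(2) w(2) by simp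
    qed
    have "item_code (tell 0 (pairs_key (kn u)) (received (g.sent_by t) u) (g.sent_by t u)) \<le> Z ^ 11"
      using item_code_tell_le[of 0 "pairs_key (kn u)" "received (g.sent_by t) u" Z 4] keys Z by simp
    moreover have "g.last_change t u \<le> Z ^ 11"
      using g.last_change_le_quiet[OF u, of t] small_quantities(2) Zp[of 1 11] by (simp add: Z_def)
    ultimately have s: "prod_encode (g.last_change t u,
        item_code (tell 0 (pairs_key (kn u)) (received (g.sent_by t) u) (g.sent_by t u))) \<le> Z ^ 24"
      using prod_encode_le[of _ Z 11] Z by simp
    have "max_id t u \<le> Z ^ 24" using V_le[of "max_id t u"] max_id_in[OF u, of t] Zp[of 1 24] by simp
    then have "prod_encode (max_id t u, prod_encode (g.last_change t u,
        item_code (tell 0 (pairs_key (kn u)) (received (g.sent_by t) u) (g.sent_by t u)))) \<le> Z ^ 50"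
      using prod_encode_le[of _ Z 24] s Z by simp
    then show ?thesis using x unfolding state_gather[OF 1 u] by (simp add: Z_def)
  next
    case 2
    have keys: "e \<le> Z ^ 3 \<and> k \<le> Z ^ 3" if "(e, k) \<in> sel.known_by i u" for e k
    proof -
      have ek: "k \<in> sel.keys" "e = 0" using sel.known_sound[OF u that] by auto
      then obtain w where w: "w \<in> V" "k = level_key N (dr w) w" by (auto simp: sel_keys)
      have "k \<le> (4 * N) * N + N"
        unfolding w(2) level_key_def using less_N[OF w(1)] by (intro add_mono mult_right_mono) auto
      also have "\<dots> \<le> Z * Z * Z"
      proof -
        have "4 * N * N = Z * Z" "N \<le> Z * Z" using Z by (auto simp: Z_def)
        moreover have "2 * (Z * Z) \<le> Z * (Z * Z)" using Z by (intro mult_right_mono) auto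
        moreover have "Z * Z * Z = Z * (Z * Z)" by (rule mult.assoc)
        ultimately show ?thesis by linarith
      qed
      finally show ?thesis using ek(2) by (simp add: power3_eq_cube)
    qed
    have "item_code (tell 0 {level_key N (dr u) u} (received (sel.sent_by i) u) (sel.sent_by i u)) \<le> Z ^ 9"
      using item_code_tell_le[of 0 "{level_key N (dr u) u}" "received (sel.sent_by i) u" Z 3] keys Z by simp
    then show ?thesis using x Zp[of 9 50] unfolding 2(1) state_select[OF 2(2) u] by (simp add: Z_def)
  next
    case 3
    have keys: "e \<le> Z ^ 3 \<and> k \<le> Z ^ 3" if "(e, k) \<in> mk.known_by i u" for e k
    proof -
      have ek: "k \<in> mk.keys" "e \<le> i" using mk.known_sound[OF u that] by auto
      then have "k \<in> V" using mk.keys_eq T_subset centers_subset by auto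
      then have "k \<le> Z" by (rule V_le)
      moreover have "e \<le> 16 * Z" using ek(2) 3(2) small_quantities(3) by (simp add: Z_def)
      ultimately show ?thesis using Z3 by linarith
    qed
    have "item_code (tell 1 ({u} \<inter> (T \<union> centers)) (received (mk.sent_by i) u) (mk.sent_by i u)) \<le> Z ^ 9"
      using item_code_tell_le[of 1 "{u} \<inter> (T \<union> centers)" "received (mk.sent_by i) u" Z 3] keys Z by simp
    then show ?thesis using x Zp[of 9 50] unfolding 3(1) state_search[OF 3(2) u] by (simp add: Z_def)
  next
    case 4
    then have "forwards i u x v" using x msg_mark[OF u] unfolding 4(1) state_mark[OF 4(2) u] by simp
    then have "x \<in> V" using mk.keys_eq T_subset centers_subset by (auto simp: forwards_def)
    then have "x \<le> Z ^ 50" using V_le[of x] Zp[of 1 50] by simp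
    then show ?thesis by (simp add: Z_def)
  next
    case 5
    then show ?thesis using x state_after[OF u 5] by simp
  qed
qed

text \<open>Taking the \<open>Q\<close> nodes of largest level needs no knowledge of the number of nodes, and still
  contains an independent sample whenever that sample is not too large.\<close>

lemma sampled_subset_centers:
  assumes "q \<noteq> 0" "j \<le> 4 * N" "card {v \<in> V. j \<le> dr v} \<le> Q"
  shows "{v \<in> V. j \<le> dr v} \<subseteq> centers"
proof
  define Z where "Z = {v \<in> V. j \<le> dr v}"
  have fZ: "finite Z" using finite_V by (simp add: Z_def)
  fix v assume "v \<in> {v \<in> V. j \<le> dr v}"
  then have v: "v \<in> V" "v \<in> Z" "j \<le> min (dr v) (4 * N)" using assms(2) by (auto simp: Z_def)
  define x where "x = level_key N (dr v) v"
  have "{k' \<in> sel.keys. k' < x} \<subseteq> (\<lambda>w. level_key N (dr w) w) ` (Z - {v})"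
  proof
    fix k' assume "k' \<in> {k' \<in> sel.keys. k' < x}"
    then obtain w where w: "w \<in> V" "k' = level_key N (dr w) w" "k' < x" by (auto simp: sel_keys)
    \<comment> \<open>In a key the level is the leading digit in base \<open>N\<close> and the
      identifier the last one. A key below that of \<open>v\<close> therefore belongs to a node
      whose capped level is at least as high.\<close>
    have "(4 * N - min (dr w) (4 * N)) * N < (4 * N - min (dr v) (4 * N)) * N + N"
      using w(2,3) less_N[OF v(1)] by (simp add: level_key_def x_def)
    then have "(4 * N - min (dr w) (4 * N)) * N < Suc (4 * N - min (dr v) (4 * N)) * N" by simp
    then have "4 * N - min (dr w) (4 * N) < Suc (4 * N - min (dr v) (4 * N))" by (metis mult_less_cancel2)
    then have "min (dr v) (4 * N) \<le> min (dr w) (4 * N)" by linarith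
    then have "j \<le> dr w" using v(3) by linarith
    then have "w \<in> Z" using w(1) by (simp add: Z_def)
    moreover have "w \<noteq> v" using w(2,3) by (auto simp: x_def)
    ultimately show "k' \<in> (\<lambda>w. level_key N (dr w) w) ` (Z - {v})" using w(2) by auto
  qed
  then have "card {k' \<in> sel.keys. k' < x} \<le> card ((\<lambda>w. level_key N (dr w) w) ` (Z - {v}))"
    using fZ by (intro card_mono) auto
  also have "\<dots> \<le> card (Z - {v})" using fZ by (intro card_image_le) auto
  also have "\<dots> < card Z" using v(2) fZ by (intro psubset_card_mono) auto
  also have "\<dots> \<le> q" using assms(1,3) by (simp add: Z_def q_def split: if_splits)
  finally have "x \<in> smallest q sel.keys" using v(1) by (auto simp: smallest_def sel_keys x_def)
  then have "x mod N \<in> centers" using assms(1) by (auto simp: centers_def)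
  then show "v \<in> centers" using level_key_mod[OF v(1)] by (simp add: x_def)
qed

lemma num_bought_small:
  "q = 0 \<Longrightarrow> mk.num_bought \<le> card V * card T"
  using mk.num_bought_all by (simp add: centers_def)

lemma num_bought_sampled:
  assumes "q \<noteq> 0" "j \<le> 4 * N" "card {v \<in> V. j \<le> dr v} \<le> Q"
    and hits: "\<And>k x m. k \<in> V \<Longrightarrow> x \<in> V \<Longrightarrow> m \<le> hop k x \<Longrightarrow> l \<le> card (high_anc h k x m) \<Longrightarrow>
      \<exists>y\<in>(\<Union>v\<in>high_anc h k x m. nbrs v). j \<le> dr y"
  shows "mk.num_bought \<le> card V * Q + card V * h + 2 * card P * (l - 1)"
proof -
  have "\<exists>v\<in>high_anc h k x m. mk.hit v"
    if prems: "k \<in> V" "x \<in> V" "m \<le> hop k x" "l \<le> card (high_anc h k x m)" for k x m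
  proof -
    obtain v y where vy: "v \<in> high_anc h k x m" "y \<in> nbrs v" "j \<le> dr y" using hits[OF prems] by auto
    then have e: "(y, v) \<in> E" "y \<in> V" using E_sym E_subset by (auto simp: nbrs_def)
    then have "y \<in> centers" using sampled_subset_centers[OF assms(1-3)] vy(3) by auto
    then have "mk.hit v" using hop_edge[OF e(1)] unfolding mk.hit_def by (intro bexI[of _ y]) simp_all
    then show ?thesis using vy(1) by auto
  qed
  then have "mk.num_bought \<le> card V * card centers + card V * h + 2 * card P * (l - 1)"
    by (intro mk.num_bought_le finite_P)
  moreover have "card V * card centers \<le> card V * Q"
    using card_centers assms(1) by (intro mult_left_mono) (auto simp: q_def split: if_splits)
  ultimately show ?thesis by linarith
qed

lemma card_T_le: "card T \<le> 2 * card P"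
proof -
  have "T \<subseteq> fst ` P \<union> snd ` P" by (force simp: T_def)
  then have "card T \<le> card (fst ` P \<union> snd ` P)" using finite_P by (intro card_mono) auto
  also have "\<dots> \<le> card (fst ` P) + card (snd ` P)" by (rule card_Un_le)
  also have "\<dots> \<le> 2 * card P" using card_image_le[OF finite_P, of fst] card_image_le[OF finite_P, of snd] by simp
  finally show ?thesis .
qed

end

section \<open>Executions in the CONGEST model\<close>

fun encode_nat :: "nat \<Rightarrow> message" where
  "encode_nat x = (if x = 0 then [] else odd x # encode_nat (x div 2))"

declare encode_nat.simps [simp del]

primrec decode_nat :: "message \<Rightarrow> nat" where
  "decode_nat [] = 0"
| "decode_nat (b # bs) = of_bool b + 2 * decode_nat bs"

lemma decode_encode_nat [simp]: "decode_nat (encode_nat x) = x"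
proof (induction x rule: encode_nat.induct)
  case (1 x)
  then show ?case by (subst encode_nat.simps) (auto simp: odd_iff_mod_2_eq_one)
qed

lemma length_encode_nat: "0 < x \<Longrightarrow> 2 ^ length (encode_nat x) \<le> 2 * x"
proof (induction x rule: encode_nat.induct)
  case (1 x)
  show ?case
  proof (cases "x div 2 = 0")
    case True
    then show ?thesis using 1(2) by (simp add: encode_nat.simps[of x] encode_nat.simps[of 0])
  next
    case False
    then have "2 ^ length (encode_nat (x div 2)) \<le> 2 * (x div 2)" using 1 by simp
    then show ?thesis using 1(2) by (simp add: encode_nat.simps[of x])
  qed
qed

lemma length_encode_nat_log:
  assumes "x \<le> n ^ p" "2 \<le> n"
  shows "real (length (encode_nat x)) \<le> real (p + 1) * log 2 (real n)"
proof (cases "x = 0")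
  case True
  then show ?thesis using assms(2) by (simp add: encode_nat.simps[of 0])
next
  case False
  have "real (2 ^ length (encode_nat x)) \<le> real (2 * x)"
    using length_encode_nat[of x] False by (intro of_nat_mono) auto
  also have "\<dots> \<le> real (n * n ^ p)" using assms by (intro of_nat_mono mult_mono) auto
  finally have "2 ^ length (encode_nat x) \<le> real n ^ (p + 1)" by simp
  then have "log 2 (2 ^ length (encode_nat x)) \<le> log 2 (real n ^ (p + 1))"
    using assms(2) by (subst log_le_cancel_iff) auto
  moreover have "log 2 (real n ^ (p + 1)) = real (p + 1) * log 2 (real n)"
    using assms(2) by (intro log_nat_power) auto
  ultimately show ?thesis by simp
qed

text \<open>In the model a node acts on its entire view; the phase is recovered by replaying the
  recorded draws and messages.\<close>

definition phase_of :: "real \<Rightarrow> local_view \<Rightarrow> phase" where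
  "phase_of a lv = foldl (\<lambda>st (d, inbox). step a (initial lv) st d (\<lambda>w. map_option decode_nat (inbox w)))
     (start (initial lv)) (history lv)"

definition algorithm :: "real \<Rightarrow> congest_algorithm" where
  "algorithm a =
     \<lparr> draw = \<lambda>lv. if history lv = [] then geometric_pmf (1/2) else return_pmf 0,
       send = \<lambda>lv d w. map_option encode_nat (msg (initial lv) (phase_of a lv) w),
       decide = \<lambda>lv. case phase_of a lv of Finished X \<Rightarrow> Some X | _ \<Rightarrow> None \<rparr>"

lemma algorithm_simps:
  "draw (algorithm a) lv = (if history lv = [] then geometric_pmf (1/2) else return_pmf 0)"
  "send (algorithm a) lv d w = map_option encode_nat (msg (initial lv) (phase_of a lv) w)"
  "decide (algorithm a) lv = (case phase_of a lv of Finished X \<Rightarrow> Some X | _ \<Rightarrow> None)"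
  by (simp_all add: algorithm_def)

lemma decide_None: "decide (algorithm a) lv = None \<longleftrightarrow> (\<forall>X. phase_of a lv \<noteq> Finished X)"
  by (auto simp: algorithm_simps split: phase.splits)

primrec outcome :: "real \<Rightarrow> nat pair_pre_digraph \<Rightarrow> (nat \<times> nat) set \<Rightarrow> (nat \<Rightarrow> nat) \<Rightarrow> nat \<Rightarrow> configuration" where
  "outcome a G P d 0 = initial_config G P"
| "outcome a G P d (Suc r) =
     next_config (algorithm a) G (outcome a G P d r) (if r = 0 then d else (\<lambda>_. 0))"

section \<open>Library distances as hop counts\<close>

lemma awalk_relpow:
  assumes "wf_digraph (with_proj H)" "pre_digraph.awalk (with_proj H) u p v"
  shows "(u, v) \<in> parcs H ^^ length p"
proof -
  have "set p \<subseteq> parcs H \<Longrightarrow> pcas u p v \<Longrightarrow> (u, v) \<in> parcs H ^^ length p"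
  proof (induction p arbitrary: u)
    case (Cons e p)
    then have "e \<in> parcs H" "fst e = u" "(snd e, v) \<in> parcs H ^^ length p" by auto
    then show ?case using relpow_Suc_I2[of u "snd e" "parcs H" v "length p"] by (cases e) simp
  qed auto
  then show ?thesis using assms(2) by (simp add: pre_digraph.awalk_def cas_with_proj_eq)
qed

lemma relpow_awalk:
  assumes "pair_wf_digraph H" "u \<in> pverts H" "(u, v) \<in> parcs H ^^ n"
  shows "\<exists>p. pre_digraph.awalk (with_proj H) u p v \<and> length p = n"
proof -
  have "\<exists>p. set p \<subseteq> parcs H \<and> pcas u p v \<and> length p = n" using assms(3)
  proof (induction n arbitrary: u)
    case 0
    then show ?case by simp
  next
    case (Suc n)
    then obtain w where "(u, w) \<in> parcs H" "(w, v) \<in> parcs H ^^ n" by (meson relpow_Suc_D2)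
    then obtain p where "set p \<subseteq> parcs H" "pcas w p v" "length p = n" "(u, w) \<in> parcs H" using Suc.IH by auto
    then show ?case by (intro exI[of _ "(u, w) # p"]) auto
  qed
  then show ?thesis using assms(2) by (auto simp: pre_digraph.awalk_def cas_with_proj_eq)
qed

lemma (in wf_digraph) awalk_cost_unit: "awalk_cost (\<lambda>_. 1) p = real (length p)"
  by (induction p) (auto simp: awalk_cost_def)

lemma gdist_le_walk:
  assumes "pair_wf_digraph H" "u \<in> pverts H" "(u, v) \<in> parcs H ^^ n"
  shows "gdist H u v \<le> ereal (real n)"
proof -
  interpret pair_wf_digraph H by fact
  obtain p where "awalk u p v" "length p = n" using relpow_awalk[OF assms] by auto
  then show ?thesis using min_cost_le_walk_cost[of u p v "\<lambda>_. 1"] by (simp add: gdist_def awalk_cost_unit)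
qed

locale congest_network =
  fixes G :: "nat pair_pre_digraph" and P :: "(nat \<times> nat) set"
  assumes graph: "pair_graph G"
    and conn: "Digraph_Component.connected (with_proj G)"
    and pairs: "P \<subseteq> pverts G \<times> pverts G"
begin

sublocale network "pverts G" "parcs G"
proof -
  interpret pair_graph G by (rule graph)
  have sym: "sym (parcs G)" using pair_sym_arcs by (simp add: symmetric_def)
  have symcl: "symcl (parcs G) = parcs G" using sym by (auto simp: symcl_def dest: symD)
  show "network (pverts G) (parcs G)"
  proof
    show "finite (pverts G)" by (rule pair_finite_verts)
    show "parcs G \<subseteq> pverts G \<times> pverts G" using in_arcsD1 in_arcsD2 by auto
    show "(u, v) \<in> parcs G \<Longrightarrow> (v, u) \<in> parcs G" for u v using sym by (rule symD)
    show "(v, v) \<notin> parcs G" for v using pair_no_loops[of "(v, v)"] by auto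
    show "(u, v) \<in> (parcs G)\<^sup>*" if "u \<in> pverts G" "v \<in> pverts G" for u v
      using conn that rtrancl_on_rtranclI[of u v] by (auto simp: connected_conv symcl)
    show "pverts G \<noteq> {}" using conn by (auto simp: connected_conv)
  qed
qed

lemma wf: "pair_wf_digraph G"
proof -
  interpret pair_graph G by (rule graph)
  show ?thesis by unfold_locales
qed

lemma gdist_eq:
  assumes "u \<in> pverts G" "v \<in> pverts G" shows "gdist G u v = ereal (real (hop u v))"
proof (rule antisym)
  show "gdist G u v \<le> ereal (real (hop u v))"
    using gdist_le_walk[OF wf assms(1) hop_relpow[OF assms]] .
  interpret pair_wf_digraph G by (rule wf)
  show "ereal (real (hop u v)) \<le> gdist G u v"
    unfolding gdist_def \<mu>_def
  proof (rule INF_greatest)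
    fix p assume "p \<in> {p. awalk u p v}"
    then have "hop u v \<le> length p"
      using awalk_relpow[OF wf_digraph_axioms] by (intro hop_le) auto
    then show "ereal (real (hop u v)) \<le> ereal (awalk_cost (\<lambda>_. 1) p)" by (simp add: awalk_cost_unit)
  qed
qed

lemma gdiameter_ge: "real diam \<le> gdiameter G"
proof -
  define B where "B = (SUP u\<in>pverts G. SUP v\<in>pverts G. gdist G u v)"
  have "B \<le> ereal (real diam)"
    unfolding B_def using hop_le_diam by (intro SUP_least) (auto simp: gdist_eq)
  moreover obtain u v where uv: "u \<in> pverts G" "v \<in> pverts G" "hop u v = diam"
  proof -
    have "{hop u v |u v. u \<in> pverts G \<and> v \<in> pverts G} \<noteq> {}" using V_nonempty by auto
    then have "diam \<in> {hop u v |u v. u \<in> pverts G \<and> v \<in> pverts G}"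
      unfolding diam_def by (intro Max_in finite_hops)
    then show ?thesis using that by auto
  qed
  then have "ereal (real diam) \<le> B"
    unfolding B_def by (intro SUP_upper2[OF uv(1)] SUP_upper2[OF uv(2)]) (simp add: gdist_eq)
  ultimately have "B = ereal (real diam)" by (rule antisym)
  then show ?thesis by (simp add: gdiameter_def B_def)
qed

end

locale congest_run = congest_network G P for G P +
  fixes dr :: "nat \<Rightarrow> nat" and a :: real
begin

sublocale execution "pverts G" "parcs G" P dr a
  by unfold_locales (rule pairs)

text \<open>The model freezes and silences a terminated node; the phase machine agrees because
  \<open>Finished\<close> is fixed by \<open>step\<close> and sends nothing. The clause on the
  history is carried along because \<open>draw\<close> tests it.\<close>

lemma outcome_state:
  "v \<in> pverts G \<Longrightarrow> initial (outcome a G P dr t v) = kn v \<and> phase_of a (outcome a G P dr t v) = state t v \<and>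
     (history (outcome a G P dr t v) = [] \<longleftrightarrow> t = 0)"
proof (induction t arbitrary: v)
  case 0
  then show ?case by (auto simp: initial_config_def kn_def phase_of_def)
next
  case (Suc t)
  define cf where "cf = outcome a G P dr t"
  define d where "d = (if t = 0 then dr else (\<lambda>_. 0))"
  have IH: "initial (cf w) = kn w" "phase_of a (cf w) = state t w" "history (cf w) = [] \<longleftrightarrow> t = 0"
    if "w \<in> pverts G" for w using Suc.IH[OF that] by (auto simp: cf_def)
  have out: "outcome a G P dr (Suc t) v = next_config (algorithm a) G cf d v" by (simp add: cf_def d_def)
  show ?case
  proof (cases "decide (algorithm a) (cf v) = None")
    case True
    have "map_option decode_nat (sent (algorithm a) G cf d w v) =
        (if (w, v) \<in> parcs G then msg (kn w) (state t w) v else None)" for w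
    proof (cases "(w, v) \<in> parcs G")
      case e: True
      then have w: "w \<in> pverts G" using E_subset by auto
      show ?thesis
      proof (cases "decide (algorithm a) (cf w) = None")
        case True
        then show ?thesis using e by (simp add: sent_def algorithm_simps IH[OF w] option.map_comp comp_def option.map_ident)
      next
        case False
        then obtain X where "state t w = Finished X" using IH(2)[OF w] by (auto simp: decide_None)
        then show ?thesis
          using False e by (cases "decide (algorithm a) (cf w)") (auto simp: sent_def)
      qed
    qed (simp add: sent_def)
    moreover have "outcome a G P dr (Suc t) v =
        (cf v)\<lparr>history := history (cf v) @ [(d v, \<lambda>u. sent (algorithm a) G cf d u v)]\<rparr>"
      unfolding out next_config_def using True Suc.prems by simp
    ultimately have "initial (outcome a G P dr (Suc t) v) = kn v"
      "phase_of a (outcome a G P dr (Suc t) v) = step a (kn v) (state t v) (d v)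
         (\<lambda>w. if (w, v) \<in> parcs G then msg (kn w) (state t w) v else None)"
      "history (outcome a G P dr (Suc t) v) \<noteq> []"
      using IH[OF Suc.prems] by (simp_all add: phase_of_def del: outcome.simps)
    then show ?thesis by (simp add: state.simps(2) d_def del: outcome.simps)
  next
    case False
    then obtain X where X: "state t v = Finished X" using IH(2)[OF Suc.prems] by (auto simp: decide_None)
    then have "t \<noteq> 0" by (cases t) (auto simp: start_def)
    moreover have "outcome a G P dr (Suc t) v = cf v"
      unfolding out next_config_def by (simp only: False simp_thms if_False)
    ultimately show ?thesis using X IH[OF Suc.prems] by (simp add: state.simps(2) del: outcome.simps)
  qed
qed

definition H :: "nat pair_pre_digraph" where
  "H = \<lparr>pverts = pverts G, parcs = mk.bought\<rparr>"

lemma outputs_H: "T4 \<le> t \<Longrightarrow> outputs_graph (algorithm a) G (outcome a G P dr t) H"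
  using outcome_state[of _ t] state_after[of _ t]
  by (simp add: outputs_graph_def algorithm_simps H_def)

lemma graph_H: "pair_graph H"
proof -
  have b: "(u, v) \<in> mk.bought \<Longrightarrow> u \<in> pverts G \<and> v \<in> pverts G \<and> u \<noteq> v" for u v
    using mk.bought_subset E_subset E_irrefl by blast
  have "finite mk.bought"
    using finite_subset[OF subset_trans[OF mk.bought_subset E_subset]] finite_V by simp
  then show ?thesis
    using b finite_V mk.bought_sym
    by unfold_locales (auto simp: H_def symmetric_def sym_def)
qed

lemma spanner_H: "pairwise_spanner 2 G P H"
proof -
  interpret GH: pair_graph H by (rule graph_H)
  interpret GG: pair_wf_digraph G by (rule wf)
  have "subgraph (with_proj H) (with_proj G)"
    unfolding subgraph_def using mk.bought_subset GH.wf_digraph_axioms GG.wf_digraph_axioms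
    by (auto simp: compatible_def H_def)
  moreover have "gdist H u v \<le> gdist G u v + ereal 2" if uv: "(u, v) \<in> P" for u v
  proof -
    have V: "u \<in> pverts G" "v \<in> pverts G" using uv pairs by auto
    obtain n where n: "n \<le> hop u v + 2" "(u, v) \<in> mk.bought ^^ n" using mk.bought_stretch[OF uv] by auto
    have "gdist H u v \<le> ereal (real n)"
      using gdist_le_walk[OF GH.pair_wf_digraph, of u v n] n(2) V by (simp add: H_def)
    also have "\<dots> \<le> gdist G u v + ereal 2" using n(1) by (simp add: gdist_eq[OF V])
    finally show ?thesis .
  qed
  ultimately show ?thesis using graph_H by (auto simp: pairwise_spanner_def spanning_def H_def)
qed

lemma num_edges_H: "num_edges H = mk.num_bought"
  by (simp add: num_edges_def mk.num_bought_def H_def)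

lemma card_T_eq: "card T = num_pair_nodes P"
  by (simp add: T_def num_pair_nodes_def)

lemma sent_length:
  assumes "pverts G \<subseteq> {..<n ^ k}" "card (pverts G) = n" "sent (algorithm a) G (outcome a G P dr t) d u v = Some m"
  shows "real (length m) \<le> real (50 * (k + 1) + 1) * log 2 (real n)"
proof -
  have uv: "(u, v) \<in> parcs G" using assms(3) by (auto simp: sent_def split: if_splits)
  then have u: "u \<in> pverts G" "v \<in> pverts G" using E_subset by auto
  \<comment> \<open>A message crosses an arc between distinct nodes, so \<open>n\<close> is at least
    2.\<close>
  then have "card {u, v} \<le> n" using assms(2) finite_V by (metis card_mono empty_subsetI insert_subset)
  then have n: "2 \<le> n" using uv E_irrefl by (cases "u = v") auto
  obtain x where x: "m = encode_nat x" "msg (kn u) (state t u) v = Some x"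
    using assms(3) uv outcome_state[OF u(1), of t]
    by (auto simp: sent_def algorithm_simps split: if_splits)
  have "Max (pverts G) \<in> pverts G" using finite_V V_nonempty by simp
  then have "N \<le> n ^ k" using assms(1) by (auto simp: N_def)
  \<comment> \<open>The factor 2 costs one more power of \<open>n\<close>; the 50th power then
    explains the constant, whose final \<open>+ 1\<close> pays for the length of the binary
    code.\<close>
  then have "2 * N \<le> n ^ (k + 1)" using n mult_mono[of 2 n N "n ^ k"] by (simp flip: Suc_eq_plus1)
  then have "(2 * N) ^ 50 \<le> (n ^ (k + 1)) ^ 50" by (intro power_mono) auto
  also have "\<dots> = n ^ (50 * (k + 1))" by (simp only: power_mult[symmetric] mult.commute)
  finally have "x \<le> n ^ (50 * (k + 1))"
    using msg_le[OF _ u(1) x(2)] n assms(2) by linarith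
  then show ?thesis unfolding x(1) by (rule length_encode_nat_log[OF _ n])
qed

end

context congest_network
begin

abbreviation seeds :: "(nat \<Rightarrow> nat) pmf" where
  "seeds \<equiv> Pi_pmf (pverts G) 0 (\<lambda>_. geometric_pmf (1/2))"

text \<open>Only a node with empty history draws a level; all later draws are the constant
  \<open>0\<close>. The iterated bind hence collapses to the image of one product distribution,
  drawn in the first round.\<close>

lemma run_eq:
  "run (algorithm a) G P (Suc r) = map_pmf (\<lambda>d. outcome a G P d (Suc r)) seeds"
proof (induction r)
  case 0
  have "draws (algorithm a) G (initial_config G P) = seeds"
    by (simp add: draws_def algorithm_simps initial_config_def)
  then show ?case by (simp add: bind_return_pmf)
next
  case (Suc r)
  have "draws (algorithm a) G (outcome a G P d (Suc r)) = return_pmf (\<lambda>_. 0)" for d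
  proof -
    interpret congest_run G P d a by unfold_locales
    have "Pi_pmf (pverts G) 0 (\<lambda>v. draw (algorithm a) (outcome a G P d (Suc r) v)) =
        Pi_pmf (pverts G) 0 (\<lambda>v. return_pmf 0)"
      using outcome_state[of _ "Suc r"] by (intro Pi_pmf_cong) (simp_all add: algorithm_simps)
    then show ?thesis using finite_V by (simp add: draws_def)
  qed
  then have step: "map_pmf (next_config (algorithm a) G (outcome a G P d (Suc r)))
      (draws (algorithm a) G (outcome a G P d (Suc r))) = return_pmf (outcome a G P d (Suc (Suc r)))" for d
    by simp
  show ?case
    unfolding run.simps(2)[of _ _ _ "Suc r"] Suc.IH bind_map_pmf step by (simp only: map_pmf_def)
qed

lemma run_outcome: "cf \<in> set_pmf (run (algorithm a) G P r) \<Longrightarrow> \<exists>d. cf = outcome a G P d r"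
proof (cases r)
  case (Suc r')
  assume "cf \<in> set_pmf (run (algorithm a) G P r)"
  then show ?thesis unfolding Suc run_eq by auto
qed simp

lemma bandwidth:
  assumes "pverts G \<subseteq> {..<n ^ k}" "card (pverts G) = n"
  shows "respects_bandwidth (real (50 * (k + 1) + 1)) (algorithm a) G P"
  unfolding respects_bandwidth_def
proof (intro allI ballI impI)
  fix r cf d u v m
  assume "cf \<in> set_pmf (run (algorithm a) G P r)" and s: "sent (algorithm a) G cf d u v = Some m"
  from run_outcome[OF this(1)] obtain d' where cf: "cf = outcome a G P d' r" by auto
  interpret congest_run G P d' a by unfold_locales
  show "real (length m) \<le> real (50 * (k + 1) + 1) * log 2 (real (card (pverts G)))"
    using sent_length[OF assms] s assms(2) unfolding cf by simp
qed

end

section \<open>Random centers\<close>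

lemma geometric_tail: "measure_pmf.prob (geometric_pmf (1/2)) {j..} = (1/2) ^ j"
proof -
  have "measure_pmf.prob (geometric_pmf (1/2)) {..<j} = (\<Sum>i<j. (1/2) ^ Suc i :: real)"
    by (subst measure_measure_pmf_finite) (auto simp: mult.commute)
  also have "\<dots> = 1 - (1/2) ^ j" by (induction j) (auto simp: field_simps)
  finally have "measure_pmf.prob (geometric_pmf (1/2)) {..<j} = 1 - (1/2) ^ j" .
  moreover have "{j..} = UNIV - {..<j}" by auto
  ultimately show ?thesis
    using measure_pmf.prob_compl[of "{..<j}" "geometric_pmf (1/2)"] by simp
qed

lemma geometric_head: "measure_pmf.prob (geometric_pmf (1/2)) {..<j} = 1 - (1/2) ^ j"
  using measure_pmf.prob_compl[of "{j..}" "geometric_pmf (1/2)"] geometric_tail[of j]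
  by (simp add: Compl_eq_Diff_UNIV[symmetric] flip: Compl_atLeast)

text \<open>The least \<open>j\<close> satisfying the first bound works: it fails for
  \<open>j - 1\<close>, which is the second bound up to the factor 2 between consecutive levels, and
  for \<open>j = 0\<close> the second bound follows from \<open>Q <= n\<close>. The third bound
  keeps \<open>j\<close> below the cap in \<open>level_key\<close>.\<close>

lemma level_choice:
  assumes "1 \<le> Q" "Q \<le> n"
  obtains j :: nat where "real n * (1/2) ^ j \<le> real Q / 4" "real Q / (8 * real n) \<le> (1/2) ^ j" "j \<le> 4 * n"
proof -
  define good where "good j \<longleftrightarrow> real n * (1/2) ^ j \<le> real Q / 4" for j :: nat
  have "4 * n < 2 ^ (4 * n)" by (rule less_exp)
  then have "real (4 * n) \<le> 2 ^ (4 * n)" by (metis less_imp_le of_nat_le_iff of_nat_numeral of_nat_power)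
  moreover have "1 \<le> real Q" using assms by simp
  ultimately have "real (4 * n) * 1 \<le> 2 ^ (4 * n) * real Q" by (intro mult_mono) auto
  then have ex: "good (4 * n)" by (simp add: good_def field_simps)
  define j where "j = (LEAST j. good j)"
  have j: "good j" "j \<le> 4 * n"
    unfolding j_def using ex by (auto intro: LeastI Least_le)
  have "real Q / (8 * real n) \<le> (1/2) ^ j"
  proof (cases j)
    case 0
    then show ?thesis using assms by (simp add: field_simps)
  next
    case (Suc i)
    then have "\<not> good i" unfolding j_def by (metis lessI not_less_Least)
    then show ?thesis using Suc assms by (simp add: good_def field_simps)
  qed
  then show ?thesis using that j by (auto simp: good_def)
qed

context congest_network
begin

lemma miss_prob:
  assumes "Y \<subseteq> pverts G"
  shows "measure_pmf.prob seeds {d. \<forall>y\<in>Y. d y < j} = (1 - (1/2) ^ j) ^ card Y"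
proof -
  define B where "B y = (if y \<in> Y then {..<j} else UNIV)" for y
  have "{d. \<forall>y\<in>Y. d y < j} = Pi (pverts G) B" using assms by (auto simp: B_def Pi_def)
  then have "measure_pmf.prob seeds {d. \<forall>y\<in>Y. d y < j} =
      (\<Prod>y\<in>pverts G. measure_pmf.prob (geometric_pmf (1/2)) (B y))"
    using measure_Pi_pmf_Pi[OF finite_V] by simp
  also have "\<dots> = (\<Prod>y\<in>pverts G. if y \<in> Y then 1 - (1/2) ^ j else 1)"
    by (intro prod.cong refl) (auto simp: B_def geometric_head)
  also have "\<dots> = (1 - (1/2) ^ j) ^ card Y"
    using assms finite_V by (simp add: prod.If_cases Int_absorb1)
  finally show ?thesis .
qed

text \<open>Markov's inequality for 2 to the number of nodes of level at least \<open>j\<close>. By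
  independence the expectation is a product with factors \<open>1 + 2^-j\<close>, each at most
  \<open>exp (2^-j)\<close>.\<close>

lemma overfull_prob:
  "measure_pmf.prob seeds {d. s < card {v \<in> pverts G. j \<le> d v}} \<le>
     exp (real (card (pverts G)) * (1/2) ^ j) / 2 ^ s"
proof -
  define f where "f d = (\<Prod>v\<in>pverts G. if j \<le> d v then 2 else 1 :: real)" for d :: "nat \<Rightarrow> nat"
  have f: "f d = 2 ^ card {v \<in> pverts G. j \<le> d v}" for d
    using finite_V by (simp add: f_def prod.If_cases Int_def)
  have "f d \<le> 2 ^ card (pverts G)" for d
    unfolding f using finite_V by (intro power_increasing card_mono) auto
  then have int: "integrable (measure_pmf seeds) f"
    by (intro measure_pmf.integrable_const_bound[where B = "2 ^ card (pverts G)"]) (auto simp: f)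
  have one: "measure_pmf.expectation (geometric_pmf (1/2)) (\<lambda>l. if j \<le> l then 2 else 1 :: real) = 1 + (1/2) ^ j"
  proof -
    have "(\<lambda>l. if j \<le> l then 2 else 1 :: real) = (\<lambda>l. 1 + indicator {j..} l)" by (auto simp: fun_eq_iff)
    moreover have "integrable (measure_pmf (geometric_pmf (1/2))) (indicator {j..} :: nat \<Rightarrow> real)"
      by (rule measure_pmf.integrable_const_bound[where B = 1]) auto
    ultimately have "measure_pmf.expectation (geometric_pmf (1/2)) (\<lambda>l. if j \<le> l then 2 else 1 :: real) =
        measure_pmf.expectation (geometric_pmf (1/2)) (\<lambda>_. 1) +
        measure_pmf.expectation (geometric_pmf (1/2)) (indicator {j..})"
      by (simp only: Bochner_Integration.integral_add measure_pmf.integrable_const)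
    then show ?thesis by (simp add: geometric_tail)
  qed
  have "measure_pmf.expectation seeds f = (\<Prod>v\<in>pverts G. 1 + (1/2) ^ j)"
    unfolding f_def
    by (subst expectation_prod_Pi_pmf[OF finite_V, where f = "\<lambda>_ l. if j \<le> l then 2 else 1 :: real"])
      (auto simp: one intro!: measure_pmf.integrable_const_bound[where B = 2])
  also have "\<dots> = (1 + (1/2) ^ j) ^ card (pverts G)" by simp
  also have "\<dots> \<le> exp ((1/2) ^ j) ^ card (pverts G)"
    by (intro power_mono exp_ge_add_one_self) auto
  also have "\<dots> = exp (real (card (pverts G)) * (1/2) ^ j)" by (simp add: exp_of_nat_mult)
  finally have E: "measure_pmf.expectation seeds f \<le> exp (real (card (pverts G)) * (1/2) ^ j)" .
  have "measure_pmf.prob seeds {d. s < card {v \<in> pverts G. j \<le> d v}} \<le> measure_pmf.prob seeds {d. 2 ^ s \<le> f d}"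
    by (intro measure_pmf.finite_measure_mono) (auto simp: f)
  also have "\<dots> \<le> measure_pmf.expectation seeds f / 2 ^ s"
  proof -
    have "AE d in measure_pmf seeds. 0 \<le> f d" by (simp add: f)
    then show ?thesis using integral_Markov_inequality_measure[OF int, of UNIV "2 ^ s"] by simp
  qed
  also have "\<dots> \<le> exp (real (card (pverts G)) * (1/2) ^ j) / 2 ^ s" using E by (intro divide_right_mono) auto
  finally show ?thesis .
qed

end

text \<open>Nodes compute the sample size with \<open>N\<close> for \<open>n\<close>: since
  \<open>n <= N <= n^k\<close>, the logarithm grows at most \<open>k\<close>-fold, and rounding up
  costs at most \<open>x\<close> because \<open>x\<close> is at least 1.\<close>

lemma sample_size_bounds:
  fixes n p N k :: nat and a :: real
  assumes n: "2 \<le> n" "n \<le> N" "N \<le> n ^ k" and a: "0 \<le> a" and p: "1 \<le> p"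
  defines "x \<equiv> real p powr (1/3) * log 2 (real n) powr (2/3)"
  shows "1 \<le> x" "a * x \<le> real (sample_size a p N)" "real (sample_size a p N) \<le> (a * real k + 1) * x"
    "x ^ 3 = real p * log 2 (real n) ^ 2"
proof -
  define L where "L = log 2 (real n)"
  have L: "1 \<le> L" using n by (simp add: L_def le_log_iff)
  have k: "1 \<le> k" using n by (cases k) auto
  have LN: "L \<le> log 2 (real N)" using n by (simp add: L_def)
  have "real N \<le> real n ^ k" using n(3) by (metis of_nat_le_iff of_nat_power)
  then have "log 2 (real N) \<le> log 2 (real n ^ k)" using n by (subst log_le_cancel_iff) auto
  also have "\<dots> = real k * L" using n by (simp add: L_def log_nat_power)
  finally have NL: "log 2 (real N) \<le> real k * L" .
  have P1: "1 \<le> real p powr (1/3)" using p ge_one_powr_ge_zero[of "real p" "1/3"] by simp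
  have L1: "1 \<le> L powr (2/3)" using L ge_one_powr_ge_zero[of L "2/3"] by simp
  show x1: "1 \<le> x" unfolding x_def L_def[symmetric] using mult_mono[OF P1 L1] by simp
  define y where "y = a * real p powr (1/3) * log 2 (real N) powr (2/3)"
  have y0: "0 \<le> y" using a by (simp add: y_def)
  have "a * x \<le> y" unfolding x_def y_def L_def[symmetric] using a LN L
    by (simp add: mult.assoc mult_left_mono powr_mono2)
  also have "\<dots> \<le> real (sample_size a p N)" unfolding sample_size_def y_def[symmetric] by linarith
  finally show "a * x \<le> real (sample_size a p N)" .
  have "log 2 (real N) powr (2/3) \<le> (real k * L) powr (2/3)" using NL LN L by (intro powr_mono2) auto
  also have "\<dots> = real k powr (2/3) * L powr (2/3)" using L by (simp add: powr_mult)
  also have "\<dots> \<le> real k * L powr (2/3)"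
    using k powr_mono[of "2/3" 1 "real k"] by (intro mult_right_mono) auto
  finally have "y \<le> a * real p powr (1/3) * (real k * L powr (2/3))"
    unfolding y_def using a by (intro mult_left_mono) auto
  then have "y \<le> a * real k * x" by (simp add: x_def L_def algebra_simps)
  moreover have "real (sample_size a p N) \<le> y + 1"
    unfolding sample_size_def y_def[symmetric] using y0 by linarith
  ultimately show "real (sample_size a p N) \<le> (a * real k + 1) * x" using x1 by (simp add: algebra_simps)
  have "(real p powr (1/3)) ^ 3 = real p" using p by (simp add: powr_power)
  moreover have "(L powr (2/3)) ^ 3 = L ^ 2" using L by (simp add: powr_power)
  ultimately show "x ^ 3 = real p * log 2 (real n) ^ 2"
    unfolding x_def L_def[symmetric] by (simp add: power_mult_distrib)
qed

section \<open>The spanner is small with high probability\<close>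

context congest_network
begin

lemma sampled_size:
  fixes c :: real and k n :: nat
  assumes c: "0 < c" and n: "n = card (pverts G)" "2 \<le> n" and ids: "pverts G \<subseteq> {..<n ^ k}"
  defines "a \<equiv> 3 * (c + 1)"
  defines "x \<equiv> real (card P) powr (1/3) * log 2 (real n) powr (2/3)"
  assumes large: "sample_size a (card P) (Suc (Max (pverts G))) < num_pair_nodes P"
  shows "measure_pmf.prob seeds
      {d. real (num_edges (congest_run.H G P d a)) \<le> (2 * (a * real k + 1) + 48 * (c + 4)) * real n * x}
    \<ge> 1 - real n powr (- c)"
proof -
  define N where "N = Suc (Max (pverts G))"
  define Q where "Q = sample_size a (card P) N"
  define L where "L = log 2 (real n)"
  define T where "T = {u. \<exists>v. (u, v) \<in> P \<or> (v, u) \<in> P}"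
  interpret r: congest_run G P "\<lambda>_. 0" a by unfold_locales
  have T: "r.T = T" by (simp add: r.T_def T_def)
  have QT: "Q < card T" using large by (simp add: Q_def N_def T_def num_pair_nodes_def)
  have Tn: "card T \<le> n" using card_mono[OF finite_V r.T_subset] T n by simp
  have TP: "card T \<le> 2 * card P" using r.card_T_le T by simp
  have P1: "1 \<le> card P" using QT TP by linarith
  have nN: "n \<le> N" using r.card_V_le_N n by (simp add: N_def r.N_def)
  have "Max (pverts G) \<in> pverts G" using finite_V V_nonempty by simp
  then have Nn: "N \<le> n ^ k" using ids by (auto simp: N_def)
  have a: "3 \<le> a" using c by (simp add: a_def)
  have bounds: "1 \<le> x" "a * x \<le> real Q" "real Q \<le> (a * real k + 1) * x" "x ^ 3 = real (card P) * L ^ 2"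
    using sample_size_bounds[OF n(2) nN Nn _ P1, of a] a by (simp_all add: Q_def L_def x_def)
  have L1: "1 \<le> L" using n by (simp add: L_def le_log_iff)
  have "3 * x \<le> a * x" using a bounds(1) by (intro mult_right_mono) auto
  then have Qx: "3 * x \<le> real Q" using bounds(2) by linarith
  have Q1: "1 \<le> Q" using Qx bounds(1) by linarith
  \<comment> \<open>This uses that the terminals outnumber \<open>Q\<close>. From
    \<open>x <= card P\<close> and \<open>x^3 = card P * L^2\<close> follow first
    \<open>L <= card P\<close> and then \<open>L <= x\<close>, so that \<open>Q\<close> is at least
    \<open>3 (c + 1) L\<close>, large enough for the tail bound on the sample.\<close>
  have "x \<le> real (card P)"
  proof -
    have "real Q \<le> 2 * real (card P)" using QT TP by linarith
    then show ?thesis using Qx bounds(1) by linarith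
  qed
  then have "x ^ 3 \<le> real (card P) ^ 3" using bounds(1) by (intro power_mono) auto
  then have "real (card P) * L ^ 2 \<le> real (card P) * real (card P) ^ 2"
    unfolding bounds(4) by (simp add: power3_eq_cube power2_eq_square mult.assoc)
  then have "L ^ 2 \<le> real (card P) ^ 2" using P1 by simp
  then have PL: "L \<le> real (card P)" by (rule power2_le_imp_le) simp
  have "L * L ^ 2 \<le> real (card P) * L ^ 2" by (rule mult_right_mono[OF PL]) simp
  then have "L ^ 3 \<le> x ^ 3"
    unfolding bounds(4) by (simp only: power3_eq_cube power2_eq_square mult.assoc)
  then have Lx: "L \<le> x" using bounds(1) L1 by (simp add: power_mono_iff)
  have lnL: "ln (real n) \<le> L"
  proof -
    have "ln (real n) = L * ln 2" by (simp add: L_def log_def)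
    also have "\<dots> \<le> L * 1" using L1 ln_2_less_1 by (intro mult_left_mono) auto
    finally show ?thesis by simp
  qed
  have npowr: "exp (- y) \<le> real n powr (- s)" if "s * L \<le> y" "0 \<le> s" for y s
  proof -
    have "s * ln (real n) \<le> s * L" using lnL that(2) by (rule mult_left_mono)
    then show ?thesis using that(1) n by (simp add: powr_def)
  qed
  obtain j where j: "real n * (1/2) ^ j \<le> real Q / 4" "real Q / (8 * real n) \<le> (1/2) ^ j" "j \<le> 4 * n"
    using level_choice[of Q n] Q1 QT Tn by auto
  \<comment> \<open>\<open>l\<close> nodes of degree \<open>Q\<close> on a shortest path have at least \<open>Q l / 3\<close> neighbours, each of which is
    a center with probability at least \<open>Q / (8 n)\<close>; \<open>w\<close> makes the expected number of centers among
    them \<open>(c + 4) L\<close>, enough for a union bound over \<open>n\<^sup>3\<close> paths.\<close>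
  define w where "w = 24 * real n * (c + 4) * L / real Q ^ 2"
  define l where "l = nat \<lceil>w\<rceil>"
  have w0: "0 \<le> w" using c L1 by (simp add: w_def)
  have lw: "w \<le> real l" "real (l - 1) \<le> w" using w0 unfolding l_def by linarith+
  define Y where "Y t = (case t of (i, u, m) \<Rightarrow> \<Union>v\<in>high_anc Q i u m. nbrs v)" for t
  define I where "I = {(i, u, m). i \<in> pverts G \<and> u \<in> pverts G \<and> m \<le> hop i u \<and> l \<le> card (high_anc Q i u m)}"
  have "I \<subseteq> pverts G \<times> pverts G \<times> {..<n}"
  proof
    fix t assume "t \<in> I"
    then obtain i u m where t: "t = (i, u, m)" "i \<in> pverts G" "u \<in> pverts G" "m \<le> hop i u"
      by (auto simp: I_def)
    then show "t \<in> pverts G \<times> pverts G \<times> {..<n}" using hop_less_card[of i u] n(1) by simp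
  qed
  moreover have fin3: "finite (pverts G \<times> pverts G \<times> {..<n})" using finite_V by simp
  ultimately have finI: "finite I" and "card I \<le> card (pverts G \<times> pverts G \<times> {..<n})"
    by (rule finite_subset, intro card_mono)
  then have cI: "card I \<le> n ^ 3" using n(1) by (simp add: card_cartesian_product power3_eq_cube)
  define over where "over = {d. Q < card {v \<in> pverts G. j \<le> d v}}"
  define miss where "miss t = {d. \<forall>y\<in>Y t. d y < j}" for t
  have p_over: "measure_pmf.prob seeds over \<le> real n powr (- (c + 1))"
  proof -
    have "measure_pmf.prob seeds over \<le> exp (real n * (1/2) ^ j) / 2 ^ Q"
      unfolding over_def using overfull_prob[of Q j] n by simp
    also have "2 ^ Q = exp (real Q * ln 2)" by (simp add: exp_of_nat_mult)
    also have "exp (real n * (1/2) ^ j) / exp (real Q * ln 2) = exp (- (real Q * ln 2 - real n * (1/2) ^ j))"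
      by (simp add: exp_diff[symmetric])
    also have "\<dots> \<le> real n powr (- (c + 1))"
    proof (rule npowr)
      have "(c + 1) * L \<le> (c + 1) * x" using Lx c by (intro mult_left_mono) auto
      also have "3 * ((c + 1) * x) \<le> real Q" using bounds(2) unfolding a_def by (simp only: mult.assoc)
      \<comment> \<open>The factor 3 in \<open>a\<close> gives \<open>(c + 1) x <= Q / 3\<close>,
        and \<open>5 / 12 = 2 / 3 - 1 / 4\<close> is what remains after \<open>ln 2 >= 2 / 3\<close>
        and the expected sample size of at most \<open>Q / 4\<close>.\<close>
      then have "(c + 1) * x \<le> 5 / 12 * real Q" using c bounds(1) by simp
      also have "real Q * (2/3) \<le> real Q * ln 2" using ln2_ge_two_thirds by (intro mult_left_mono) auto
      then have "5 / 12 * real Q \<le> real Q * ln 2 - real n * (1/2) ^ j" using j(1) by linarith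
      finally show "(c + 1) * L \<le> real Q * ln 2 - real n * (1/2) ^ j" .
    qed (use c in simp)
    finally show ?thesis .
  qed
  have p_miss: "measure_pmf.prob seeds (miss t) \<le> real n powr (- (c + 4))" if "t \<in> I" for t
  proof -
    obtain i u m where t: "t = (i, u, m)" by (cases t)
    have t': "i \<in> pverts G" "u \<in> pverts G" "m \<le> hop i u" "l \<le> card (high_anc Q i u m)"
      using that by (auto simp: I_def t)
    have YV: "Y t \<subseteq> pverts G" using E_subset by (auto simp: Y_def t nbrs_def)
    have "Q * l \<le> Q * card (high_anc Q i u m)" by (rule mult_left_mono[OF t'(4)]) simp
    also have "\<dots> \<le> 3 * card (Y t)" using card_nbrs_high_anc[OF t'(1-3), of Q] by (simp add: Y_def t)
    finally have "Q * l \<le> 3 * card (Y t)" .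
    then have "real (Q * l) \<le> real (3 * card (Y t))" by (rule of_nat_mono)
    then have Yc: "real Q * real l / 3 \<le> real (card (Y t))" by simp
    have "measure_pmf.prob seeds (miss t) = (1 - (1/2) ^ j) ^ card (Y t)"
      unfolding miss_def by (rule miss_prob[OF YV])
    also have "\<dots> \<le> exp (- ((1/2) ^ j)) ^ card (Y t)"
      using exp_ge_add_one_self[of "- ((1/2) ^ j :: real)"]
      by (intro power_mono) (auto simp: power_le_one)
    also have "\<dots> = exp (- (real (card (Y t)) * (1/2) ^ j))" by (simp add: exp_of_nat_mult[symmetric])
    also have "\<dots> \<le> real n powr (- (c + 4))"
    proof (rule npowr)
      have "(c + 4) * L = real Q * w / 3 * (real Q / (8 * real n))"
        using Q1 n by (simp add: w_def power2_eq_square)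
      also have "\<dots> \<le> real Q * real l / 3 * (real Q / (8 * real n))"
        using lw(1) by (intro mult_right_mono divide_right_mono mult_left_mono) auto
      also have "\<dots> \<le> real (card (Y t)) * (1/2) ^ j"
        using Yc j(2) by (intro mult_mono) auto
      finally show "(c + 4) * L \<le> real (card (Y t)) * (1/2) ^ j" .
    qed (use c in simp)
    finally show ?thesis .
  qed
  define bad where "bad = over \<union> (\<Union>t\<in>I. miss t)"
  have p_bad_sum: "measure_pmf.prob seeds bad \<le>
      measure_pmf.prob seeds over + measure_pmf.prob seeds (\<Union>t\<in>I. miss t)"
    unfolding bad_def by (rule measure_Un_le) auto
  have "measure_pmf.prob seeds (\<Union>t\<in>I. miss t) \<le> (\<Sum>t\<in>I. measure_pmf.prob seeds (miss t))"
    by (rule measure_pmf.finite_measure_subadditive_finite) (use finI in auto)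
  also have "\<dots> \<le> (\<Sum>t\<in>I. real n powr (- (c + 4)))" by (intro sum_mono p_miss)
  also have "\<dots> = real (card I) * real n powr (- (c + 4))" by simp
  also have "\<dots> \<le> real (n ^ 3) * real n powr (- (c + 4))"
    using cI by (intro mult_right_mono of_nat_mono) auto
  also have "real (n ^ 3) = real n powr 3" using n(2) by simp
  also have "real n powr 3 * real n powr (- (c + 4)) = real n powr (3 + - (c + 4))"
    by (rule powr_add[symmetric])
  also have "3 + - (c + 4) = - (c + 1)" by simp
  \<comment> \<open>Both kinds of failure have probability at most
    \<open>n powr (- (c + 1))\<close>; the spare power of \<open>n\<close> absorbs the factor 2
    since \<open>n >= 2\<close>.\<close>
  finally have "measure_pmf.prob seeds bad \<le> 2 * real n powr (- (c + 1))"
    using p_over p_bad_sum by linarith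
  also have "real n powr (- (c + 1)) = real n powr (- c) / real n"
    using n(2) powr_diff[of "real n" "- c" 1] by simp
  also have "2 * (real n powr (- c) / real n) \<le> real n powr (- c)"
    using n(2) mult_right_mono[of 2 "real n" "real n powr (- c)"] by (simp add: divide_le_eq mult.commute)
  finally have p_bad: "measure_pmf.prob seeds bad \<le> real n powr (- c)" .
  have good: "real (num_edges (congest_run.H G P d a)) \<le> (2 * (a * real k + 1) + 48 * (c + 4)) * real n * x"
    if "d \<notin> bad" for d
  proof -
    interpret d: congest_run G P d a by unfold_locales
    have Qd: "d.Q = Q" "d.N = N" by (simp_all add: d.Q_def Q_def d.N_def N_def)
    have dq: "d.q \<noteq> 0" using QT Q1 T d.T_def by (simp add: d.q_def Qd T_def)
    have "d.mk.num_bought \<le> card (pverts G) * d.Q + card (pverts G) * Q + 2 * card P * (l - 1)"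
    proof (rule d.num_bought_sampled[OF dq, of j])
      show "j \<le> 4 * d.N" using j(3) nN Qd by simp
      show "card {v \<in> pverts G. j \<le> d v} \<le> d.Q" using that Qd by (auto simp: bad_def over_def)
      fix i u m assume t: "i \<in> pverts G" "u \<in> pverts G" "m \<le> hop i u" "l \<le> card (high_anc Q i u m)"
      then have "d \<notin> miss (i, u, m)" using that by (auto simp: bad_def I_def)
      then show "\<exists>y\<in>(\<Union>v\<in>high_anc Q i u m. nbrs v). j \<le> d y"
        by (auto simp: miss_def Y_def not_less)
    qed
    then have "d.mk.num_bought \<le> 2 * (n * Q) + 2 * (card P * (l - 1))"
      unfolding Qd n(1)[symmetric] by (simp add: ac_simps)
    then have "real d.mk.num_bought \<le> real (2 * (n * Q) + 2 * (card P * (l - 1)))" by (rule of_nat_mono)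
    also have "\<dots> = 2 * (real n * real Q) + 2 * (real (card P) * real (l - 1))" by simp
    also have "\<dots> \<le> 2 * (real n * ((a * real k + 1) * x)) + 2 * (24 * (c + 4) * real n * x)"
    proof (intro add_mono mult_left_mono)
      show "real Q \<le> (a * real k + 1) * x" by (rule bounds(3))
      \<comment> \<open>The balancing of the two costs: \<open>card P * L <= x^3 <= x * Q^2\<close>,
        so the purchases on long paths cost no more, up to constants, than
        \<open>n * x\<close>.\<close>
      have "real (card P) * L \<le> real (card P) * L ^ 2"
        using L1 self_le_power[of L 2] by (intro mult_left_mono) auto
      also have "\<dots> = x * x ^ 2" using bounds(4) by (simp add: power3_eq_cube power2_eq_square)
      also have "\<dots> \<le> x * real Q ^ 2" using Qx bounds(1) by (intro mult_left_mono power_mono) auto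
      finally have "real (card P) * L / real Q ^ 2 \<le> x" using Q1 by (simp add: divide_le_eq)
      then have "24 * (c + 4) * real n * (real (card P) * L / real Q ^ 2) \<le> 24 * (c + 4) * real n * x"
        using c by (intro mult_left_mono) auto
      moreover have "real (card P) * real (l - 1) \<le> real (card P) * w" using lw(2) by (rule mult_left_mono) simp
      moreover have "real (card P) * w = 24 * (c + 4) * real n * (real (card P) * L / real Q ^ 2)"
        by (simp add: w_def)
      ultimately show "real (card P) * real (l - 1) \<le> 24 * (c + 4) * real n * x" by linarith
    qed auto
    also have "\<dots> = (2 * (a * real k + 1) + 48 * (c + 4)) * real n * x" by (simp add: algebra_simps)
    finally show ?thesis by (simp add: d.num_edges_H)
  qed
  have "1 - real n powr (- c) \<le> 1 - measure_pmf.prob seeds bad" using p_bad by simp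
  also have "\<dots> = measure_pmf.prob seeds (UNIV - bad)"
    using measure_pmf.prob_compl[of bad seeds] by simp
  also have "\<dots> \<le> measure_pmf.prob seeds
      {d. real (num_edges (congest_run.H G P d a)) \<le> (2 * (a * real k + 1) + 48 * (c + 4)) * real n * x}"
    using good by (intro measure_pmf.finite_measure_mono) auto
  finally show ?thesis .
qed

end

theorem theorem9:
  fixes c :: real and k :: nat
  assumes "c > 0"
  shows "\<exists>(A :: congest_algorithm) (B :: real) (C :: real) (K :: real).
    \<forall>(G :: nat pair_pre_digraph) (P :: (nat \<times> nat) set) (n :: nat).
      pair_graph G \<and> Digraph_Component.connected (with_proj G) \<and> card (pverts G) = n \<and>
      pverts G \<subseteq> {..<n ^ k} \<and> P \<subseteq> pverts G \<times> pverts G \<longrightarrow>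
        respects_bandwidth B A G P \<and>
        measure_pmf.prob (run A G P (nat \<lfloor>C * (real (num_pair_nodes P) + gdiameter G)\<rfloor>))
          {cf. \<exists>H. outputs_graph A G cf H \<and> pairwise_spanner 2 G P H \<and>
                real (num_edges H)
                  \<le> K * real n * real (card P) powr (1/3) * log 2 (real n) powr (2/3)}
        \<ge> 1 - real n powr (- c)"
proof -
  define a where "a = 3 * (c + 1)"
  have a0: "0 \<le> a" using assms by (simp add: a_def)
  define K where "K = 2 * (a * real k + 1) + 48 * (c + 4)"
  have main: "respects_bandwidth (real (50 * (k + 1) + 1)) (algorithm a) G P \<and>
      1 - real n powr (- c) \<le>
        measure_pmf.prob (run (algorithm a) G P (nat \<lfloor>19 * (real (num_pair_nodes P) + gdiameter G)\<rfloor>))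
          {cf. \<exists>H. outputs_graph (algorithm a) G cf H \<and> pairwise_spanner 2 G P H \<and>
                real (num_edges H)
                  \<le> K * real n * real (card P) powr (1/3) * log 2 (real n) powr (2/3)}"
    (is "_ \<and> _ \<le> measure_pmf.prob (run _ G P ?r) ?good")
    if "pair_graph G" "Digraph_Component.connected (with_proj G)" and n: "card (pverts G) = n"
      and ids: "pverts G \<subseteq> {..<n ^ k}" and "P \<subseteq> pverts G \<times> pverts G" for G P n
  proof
    interpret congest_network G P by (rule congest_network.intro) (fact that)+
    show "respects_bandwidth (real (50 * (k + 1) + 1)) (algorithm a) G P"
      by (rule bandwidth[OF ids n])
    show "1 - real n powr (- c) \<le> measure_pmf.prob (run (algorithm a) G P ?r) ?good"
    proof (cases "2 \<le> n")
      case False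
      moreover have "n \<noteq> 0" using n finite_V V_nonempty by auto
      ultimately have "n = 1" by simp
      \<comment> \<open>For a single node the claimed probability is
        \<open>1 - 1 = 0\<close>.\<close>
      then show ?thesis by simp
    next
      case n2: True
      define x where "x = real (card P) powr (1/3) * log 2 (real n) powr (2/3)"
      \<comment> \<open>A positive diameter is needed to absorb the additive constant 5 of
        \<open>T4_le\<close> into the factor 19.\<close>
      have diam1: "1 \<le> diam"
      proof -
        obtain u v where uv: "u \<in> pverts G" "v \<in> pverts G" "u \<noteq> v"
          using n n2 finite_V by (metis card_le_Suc0_iff_eq not_less_eq_eq numeral_2_eq_2)
        then have "1 \<le> hop u v" using hop_eq_0[of u v] by linarith
        then show ?thesis using hop_le_diam[OF uv(1,2)] by linarith
      qed
      have T4: "execution.T4 (pverts G) (parcs G) P d a \<le> ?r" for d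
      proof -
        interpret d: congest_run G P d a by unfold_locales
        have "d.T4 \<le> 19 * (num_pair_nodes P + diam)"
          using d.T4_le d.card_T_eq diam1 by simp
        then have "real d.T4 \<le> real (19 * (num_pair_nodes P + diam))" by (rule of_nat_mono)
        then have "real d.T4 \<le> 19 * (real (num_pair_nodes P) + real diam)" by simp
        also have "\<dots> \<le> 19 * (real (num_pair_nodes P) + gdiameter G)" using gdiameter_ge by simp
        finally show ?thesis by (rule le_nat_floor)
      qed
      \<comment> \<open>Some round takes place, so \<open>run_eq\<close>, which speaks of
        \<open>Suc r\<close> rounds, applies.\<close>
      have "execution.T4 (pverts G) (parcs G) P (\<lambda>_. 0) a \<noteq> 0"
      proof -
        interpret d: congest_run G P "\<lambda>_. 0" a by unfold_locales
        show ?thesis by (simp add: d.T4_def)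
      qed
      then obtain r where r: "?r = Suc r" using T4[of "\<lambda>_. 0"] by (cases ?r) auto
      define light where "light = {d. real (num_edges (congest_run.H G P d a)) \<le> K * real n * x}"
      have "1 - real n powr (- c) \<le> measure_pmf.prob seeds light"
      proof (cases "sample_size a (card P) (Suc (Max (pverts G))) < num_pair_nodes P")
        case True
        then show ?thesis
          using sampled_size[OF assms n[symmetric] n2 ids] by (simp add: light_def K_def a_def x_def)
      next
        case False
        have "d \<in> light" for d
        proof -
          interpret d: congest_run G P d a by unfold_locales
          have Qd: "d.Q = sample_size a (card P) (Suc (Max (pverts G)))" by (simp add: d.Q_def d.N_def)
          have TQ: "card d.T \<le> d.Q" using False by (simp add: Qd d.card_T_eq)
          then have nb: "d.mk.num_bought \<le> n * card d.T" using d.num_bought_small n by (simp add: d.q_def)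
          have "real (n * card d.T) \<le> K * real n * x"
          proof (cases "card P = 0")
            case True
            \<comment> \<open>Here \<open>0 powr (1/3) = 0\<close> makes the allowed number of edges
              zero, which is met because there are no terminals and nothing is bought.\<close>
            then have "card d.T = 0" using d.card_T_le by simp
            then show ?thesis using True by (simp add: x_def)
          next
            case False
            have "Max (pverts G) \<in> pverts G" using finite_V V_nonempty by simp
            then have "d.N \<le> n ^ k" using ids by (auto simp: d.N_def)
            then have b: "1 \<le> x" "real d.Q \<le> (a * real k + 1) * x"
              using sample_size_bounds(1,3)[of n d.N k a "card P"] n2 d.card_V_le_N n False a0
              by (simp_all add: d.Q_def x_def)
            have "real (n * card d.T) \<le> real n * real d.Q" using TQ by (simp add: mult_left_mono)
            also have "\<dots> \<le> real n * ((a * real k + 1) * x)" using b(2) by (rule mult_left_mono) simp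
            also have "\<dots> \<le> K * real n * x"
            proof -
              have "a * real k + 1 \<le> K" using assms by (simp add: K_def a_def)
              then have "(a * real k + 1) * (real n * x) \<le> K * (real n * x)"
                using b(1) by (intro mult_right_mono) auto
              then show ?thesis by (simp add: algebra_simps)
            qed
            finally show ?thesis .
          qed
          then have "real d.mk.num_bought \<le> K * real n * x" using nb by linarith
          then show ?thesis by (simp add: light_def d.num_edges_H)
        qed
        then have "light = UNIV" by auto
        then show ?thesis by simp
      qed
      also have "\<dots> \<le> measure_pmf.prob seeds ((\<lambda>d. outcome a G P d ?r) -` ?good)"
      proof (rule measure_pmf.finite_measure_mono)
        show "light \<subseteq> (\<lambda>d. outcome a G P d ?r) -` ?good"
        proof
          fix d assume "d \<in> light"
          interpret d: congest_run G P d a by unfold_locales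
          have "outputs_graph (algorithm a) G (outcome a G P d ?r) d.H" by (rule d.outputs_H[OF T4])
          moreover have "pairwise_spanner 2 G P d.H" by (rule d.spanner_H)
          moreover have "real (num_edges d.H) \<le>
              K * real n * real (card P) powr (1/3) * log 2 (real n) powr (2/3)"
            using \<open>d \<in> light\<close> by (simp add: light_def x_def mult.assoc)
          ultimately show "d \<in> (\<lambda>d. outcome a G P d ?r) -` ?good" by blast
        qed
      qed simp
      also have "\<dots> = measure_pmf.prob (run (algorithm a) G P ?r) ?good"
        unfolding r run_eq by simp
      finally show ?thesis .
    qed
  qed
  show ?thesis
    by (rule exI[of _ "algorithm a"], rule exI[of _ "real (50 * (k + 1) + 1)"], rule exI[of _ 19],
        rule exI[of _ K]) (use main in blast)
qed

end
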